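(* Let $\theta\in(\underline\theta,\bar\theta)$, let the process $\underline\omega(\cdot)$ start from the stationary product distribution $\underline\mu_\theta$, with a second class particle started from the origin whose position at time $t$ is $Q(t)$. Let $g(z)=z-\sum_{y\in I}y\,\mu_\theta(y)$. For any $n\in\mathbb Z$ and $t\ge0$, $$\mathbf{Cov}(\omega_n(t),\omega_0(0))=\mathbf E\Bigl(\widehat{\mathbf 1}\{Q(t)=n\}\cdot\sum_{z=\omega_0(0)+1}^{\omega^{\max}}g(z)\frac{\mu_\theta(z)}{\mu_\theta(\omega_0(0))}\Bigr),$$ where empty sums equal zero. Moreover, the sum $\sum_{z=\omega_0+1}^{\omega^{\max}}g(z)\frac{\mu_\theta(z)}{\mu_\theta(\omega_0)}$ is non-negative for any value $\omega_0\in I$.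
   Context: **Model.** Let $-\infty\le\omega^{\min}\le 0$ and $1\le\omega^{\max}\le\infty$ be (possibly infinite valued) integers, $I=\{z\in\mathbb Z:\omega^{\min}-1<z<\omega^{\max}+1\}$, $\Omega=I^{\mathbb Z}$, with elements $\underline\omega=(\omega_i)_{i\in\mathbb Z}$. Integer heights $h_i$ ($i\in\mathbb Z$) satisfy $\omega_i=h_{i-1}-h_i$. The dynamics: for each $i\in\mathbb Z$, at rate $p(\omega_i,\omega_{i+1})$ a brick is added, $(\omega_i,\omega_{i+1})\to(\omega_i-1,\omega_{i+1}+1)$, $h_i\to h_i+1$; at rate $q(\omega_i,\omega_{i+1})$ a brick is removed, $(\omega_i,\omega_{i+1})\to(\omega_i+1,\omega_{i+1}-1)$, $h_i\to h_i-1$. Conditionally on $\underline\omega(t)$ these moves are independent. The process is Markov with formal generator, on cylinder functions $\varphi$ (functions of finitely many coordinates), $$(L\varphi)(\underline\omega)=\sum_{i}p(\omega_i,\omega_{i+1})[\varphi(\dots,\omega_i-1,\omega_{i+1}+1,\dots)-\varphi(\underline\omega)]+\sum_i q(\omega_i,\omega_{i+1})[\varphi(\dots,\omega_i+1,\omega_{i+1}-1,\dots)-\varphi(\underline\omega)].$$ **Standing assumptions on $p,q:I\times I\to[0,\infty)$.** (1) $p(\omega^{\min},\cdot)\equiv p(\cdot,\omega^{\max})\equiv q(\omega^{\max},\cdot)\equiv q(\cdot,\omega^{\min})\equiv0$ whenever the corresponding $\omega^{\min}$ or $\omega^{\max}$ is finite. Either $p$ and $q$ are both non-zero in all other cases,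 or one of them is identically zero (and the other is non-zero in all other cases). (2) (Attractivity) $p(z+1,y)\ge p(z,y)$, $p(y,z+1)\le p(y,z)$, $q(z+1,y)\le q(z,y)$, $q(y,z+1)\ge q(y,z)$ for $y,z,z+1\in I$. (3) For all $x,y,z\in I$: $p(x,y)+p(y,z)+p(z,x)+q(x,y)+q(y,z)+q(z,x)=p(x,z)+p(z,y)+p(y,x)+q(x,z)+q(z,y)+q(y,x)$. (4) There are symmetric functions $s_p,s_q$ and a function $f$, with $f(\omega^{\min})=0$ if $\omega^{\min}$ is finite, such that $p(y,z)=s_p(y,z+1)f(y)$ and $q(y,z)=s_q(y+1,z)f(z)$ for $y,z\in I$. ($f$ is then non-decreasing on $I$.) (5) All moments of the rates $p(\omega_0,\omega_1),q(\omega_0,\omega_1)$ are finite under the distributions $\underline\mu_\theta$ below. (6) The dynamics exists on a set $\widetilde\Omega\subset\Omega$ of tempered configurations (configurations obeying some growth restrictions) of full $\underline\mu_\theta$-measure, with the usual properties of the semigroup and the generator acting on nice functions. **Stationary measures.** For $z\in I$: $f(z)!=\prod_{y=1}^zf(y)$ if $z>0$, $f(0)!=1$, $f(z)!=1/\prod_{y=z+1}^0f(y)$ if $z<0$. Let $\bar\theta=\lim_{z\to\infty}\log f(z)$ if $\omega^{\max}=\infty$, $\bar\theta=\infty$ otherwise; $\underline\theta=\lim_{z\to\infty}\log f(-z)$ if $\omega^{\min}=-\infty$, $\underline\theta=-\infty$ otherwise. Assume $\underline\theta<\bar\theta$. For $\theta\in(\underline\theta,\bar\theta)$ let $Z(\theta)=\sum_{z\in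 I}e^{\theta z}/f(z)!<\infty$, $\mu_\theta(z)=\frac1{Z(\theta)}\frac{e^{\theta z}}{f(z)!}$ for $z\in I$ and $\mu_\theta(z)=0$ for $z\notin I$. $\underline\mu_\theta$ is the product distribution on $\Omega$ with all marginals $\mu_\theta$; it is stationary for the process. **Basic coupling and second class particle.** Two copies $\underline\eta(\cdot)\le\underline\zeta(\cdot)$ (coordinatewise) of the process are coupled as follows. For each $i$ write "up" for the move $(\cdot_i,\cdot_{i+1})\to(\cdot_i-1,\cdot_{i+1}+1)$ and "down" for $(\cdot_i,\cdot_{i+1})\to(\cdot_i+1,\cdot_{i+1}-1)$. The rates are: only $\underline\zeta$ up: $p(\zeta_i,\zeta_{i+1})-p(\eta_i,\zeta_{i+1})$; only $\underline\eta$ up: $p(\eta_i,\eta_{i+1})-p(\eta_i,\zeta_{i+1})$; both up: $p(\eta_i,\zeta_{i+1})$; only $\underline\zeta$ down: $q(\zeta_i,\zeta_{i+1})-q(\zeta_i,\eta_{i+1})$; only $\underline\eta$ down: $q(\eta_i,\eta_{i+1})-q(\zeta_i,\eta_{i+1})$; both down: $q(\zeta_i,\eta_{i+1})$. This preserves $\underline\eta\le\underline\zeta$ and the total discrepancy. Let $\underline\delta_i$ be the configuration that is $1$ at site $i$ and $0$ elsewhere. If $\omega_0(0)<\omega^{\max}$, start the coupled pair $(\underline\omega,\underline\omega^+)$ (as $(\underline\eta,\underline\zeta)$) with $\underline\omega^+(0)=\underline\omega(0)+\underline\delta_0$; then $\underline\omega^+(t)=\underline\omega(t)+\underline\delta_{Q(t)}$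 for all $t\ge0$, which defines $Q(t)$, the position of the second class particle. **Notation.** $\widehat{\mathbf 1}\{\cdot\}=\mathbf 1\{\cdot\}\cdot\mathbf 1\{\omega_0(0)<\omega^{\max}\}$ (so the expression under the expectation is $0$ when $\omega_0(0)=\omega^{\max}$ and $Q$ is undefined). *)

theory Defs
  imports "HOL-Probability.Probability" "HOL-Library.Extended"
begin

section \<open>Configurations and stationary product distributions\<close>

type_synonym config = "int \<Rightarrow> int"

definition local_states :: "int extended \<Rightarrow> int extended \<Rightarrow> int set" where
  "local_states wmin wmax = {z. wmin \<le> Fin z \<and> Fin z \<le> wmax}"

text \<open>Configurations live on the full product space; the product distributions below give
  mass one to the configurations with all coordinates in \<^term>\<open>local_states wmin wmax\<close>.\<close>

definition config_space :: "config measure" where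
  "config_space = PiM UNIV (\<lambda>_. count_space UNIV)"

definition f_fact :: "(int \<Rightarrow> real) \<Rightarrow> int \<Rightarrow> real" where
  "f_fact f z = (if 0 < z then \<Prod>y\<in>{1..z}. f y else if z = 0 then 1 else 1 / (\<Prod>y\<in>{z+1..0}. f y))"

definition theta_upper :: "int extended \<Rightarrow> (int \<Rightarrow> real) \<Rightarrow> ereal" where
  "theta_upper wmax f = (if wmax = Pinf then lim (\<lambda>n. ereal (ln (f (int n)))) else PInfty)"

definition theta_lower :: "int extended \<Rightarrow> (int \<Rightarrow> real) \<Rightarrow> ereal" where
  "theta_lower wmin f = (if wmin = Minf then lim (\<lambda>n. ereal (ln (f (- int n)))) else MInfty)"

definition Z_theta :: "int extended \<Rightarrow> int extended \<Rightarrow> (int \<Rightarrow> real) \<Rightarrow> real \<Rightarrow> real" where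
  "Z_theta wmin wmax f \<theta> = (\<Sum>\<^sub>\<infinity>z\<in>local_states wmin wmax. exp (\<theta> * real_of_int z) / f_fact f z)"

definition mu :: "int extended \<Rightarrow> int extended \<Rightarrow> (int \<Rightarrow> real) \<Rightarrow> real \<Rightarrow> int \<Rightarrow> real" where
  "mu wmin wmax f \<theta> z =
     (if z \<in> local_states wmin wmax
      then 1 / Z_theta wmin wmax f \<theta> * (exp (\<theta> * real_of_int z) / f_fact f z) else 0)"

definition product_mu ::
    "int extended \<Rightarrow> int extended \<Rightarrow> (int \<Rightarrow> real) \<Rightarrow> real \<Rightarrow> config measure" where
  "product_mu wmin wmax f \<theta> =
     PiM UNIV (\<lambda>_. density (count_space UNIV) (\<lambda>z. ennreal (mu wmin wmax f \<theta> z)))"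

definition centred :: "int extended \<Rightarrow> int extended \<Rightarrow> (int \<Rightarrow> real) \<Rightarrow> real \<Rightarrow> int \<Rightarrow> real" where
  "centred wmin wmax f \<theta> z =
     real_of_int z - (\<Sum>\<^sub>\<infinity>y\<in>local_states wmin wmax. real_of_int y * mu wmin wmax f \<theta> y)"

section \<open>Rates\<close>

text \<open>Values of \<^term>\<open>p\<close>, \<^term>\<open>q\<close>, \<^term>\<open>f\<close> at arguments outside
  \<^term>\<open>local_states wmin wmax\<close> are irrelevant. If \<^term>\<open>wmin\<close> or
  \<^term>\<open>wmax\<close> is infinite then no integer \<^term>\<open>z\<close> satisfies
  \<^term>\<open>Fin z = wmin\<close>, respectively \<^term>\<open>Fin z = wmax\<close>, so the boundary
  conditions apply to finite boundaries only. The sign condition on \<^term>\<open>f\<close> is a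
  normalisation: the product form is invariant under changing the signs of \<^term>\<open>f\<close> and of
  both symmetric functions, and the logarithm of \<^term>\<open>f\<close> is taken in the definition of the
  range of \<open>\<theta>\<close>. Monotonicity of \<^term>\<open>f\<close> is a consequence, hence not
  assumed.\<close>

locale deposition_rates =
  fixes wmin wmax :: "int extended"
    and p q :: "int \<Rightarrow> int \<Rightarrow> real"
    and f :: "int \<Rightarrow> real"
  assumes wmin_le: "wmin \<le> Fin 0"
    and wmax_ge: "Fin 1 \<le> wmax"
    and rates_nonneg: "\<And>y z. y \<in> local_states wmin wmax \<Longrightarrow> z \<in> local_states wmin wmax \<Longrightarrow>
        0 \<le> p y z \<and> 0 \<le> q y z"
    and p_boundary: "\<And>y z. y \<in> local_states wmin wmax \<Longrightarrow> z \<in> local_states wmin wmax \<Longrightarrow>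
        Fin y = wmin \<or> Fin z = wmax \<Longrightarrow> p y z = 0"
    and q_boundary: "\<And>y z. y \<in> local_states wmin wmax \<Longrightarrow> z \<in> local_states wmin wmax \<Longrightarrow>
        Fin y = wmax \<or> Fin z = wmin \<Longrightarrow> q y z = 0"
    and non_degenerate:
      "let I = local_states wmin wmax;
           p_nonzero = (\<forall>y\<in>I. \<forall>z\<in>I. Fin y \<noteq> wmin \<and> Fin z \<noteq> wmax \<longrightarrow> p y z \<noteq> 0);
           q_nonzero = (\<forall>y\<in>I. \<forall>z\<in>I. Fin y \<noteq> wmax \<and> Fin z \<noteq> wmin \<longrightarrow> q y z \<noteq> 0)
       in (p_nonzero \<and> q_nonzero) \<or>
          ((\<forall>y\<in>I. \<forall>z\<in>I. p y z = 0) \<and> q_nonzero) \<or>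
          ((\<forall>y\<in>I. \<forall>z\<in>I. q y z = 0) \<and> p_nonzero)"
    and attractive: "\<And>y z. y \<in> local_states wmin wmax \<Longrightarrow> z \<in> local_states wmin wmax \<Longrightarrow>
        z + 1 \<in> local_states wmin wmax \<Longrightarrow>
        p z y \<le> p (z + 1) y \<and> p y (z + 1) \<le> p y z \<and>
        q (z + 1) y \<le> q z y \<and> q y z \<le> q y (z + 1)"
    and cyclic: "\<And>x y z. x \<in> local_states wmin wmax \<Longrightarrow> y \<in> local_states wmin wmax \<Longrightarrow>
        z \<in> local_states wmin wmax \<Longrightarrow>
        p x y + p y z + p z x + q x y + q y z + q z x =
        p x z + p z y + p y x + q x z + q z y + q y x"
    and f_nonneg: "\<And>z. z \<in> local_states wmin wmax \<Longrightarrow> 0 \<le> f z"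
    and f_boundary: "\<And>z. Fin z = wmin \<Longrightarrow> f z = 0"
    and product_form: "\<exists>sp sq :: int \<Rightarrow> int \<Rightarrow> real.
        (\<forall>y z. sp y z = sp z y) \<and> (\<forall>y z. sq y z = sq z y) \<and>
        (\<forall>y\<in>local_states wmin wmax. \<forall>z\<in>local_states wmin wmax.
           p y z = sp y (z + 1) * f y \<and> q y z = sq (y + 1) z * f z)"
    and theta_range: "theta_lower wmin f < theta_upper wmax f"
    and rate_moments: "\<And>\<theta> (k :: nat). theta_lower wmin f < ereal \<theta> \<Longrightarrow> ereal \<theta> < theta_upper wmax f \<Longrightarrow>
        integrable (product_mu wmin wmax f \<theta>) (\<lambda>\<omega>. p (\<omega> 0) (\<omega> 1) ^ k) \<and>
        integrable (product_mu wmin wmax f \<theta>) (\<lambda>\<omega>. q (\<omega> 0) (\<omega> 1) ^ k)"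

section \<open>Formal generators\<close>

definition move_up :: "int \<Rightarrow> config \<Rightarrow> config" where
  "move_up i \<omega> = fun_upd (fun_upd \<omega> i (\<omega> i - 1)) (i + 1) (\<omega> (i + 1) + 1)"

definition move_down :: "int \<Rightarrow> config \<Rightarrow> config" where
  "move_down i \<omega> = fun_upd (fun_upd \<omega> i (\<omega> i + 1)) (i + 1) (\<omega> (i + 1) - 1)"

definition cylinder :: "(config \<Rightarrow> real) \<Rightarrow> bool" where
  "cylinder \<phi> \<longleftrightarrow>
     (\<exists>F. finite F \<and> (\<forall>\<omega> \<omega>'. (\<forall>i\<in>F. \<omega> i = \<omega>' i) \<longrightarrow> \<phi> \<omega> = \<phi> \<omega>'))"

definition cylinder2 :: "(config \<times> config \<Rightarrow> real) \<Rightarrow> bool" where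
  "cylinder2 \<phi> \<longleftrightarrow>
     (\<exists>F. finite F \<and> (\<forall>\<eta> \<zeta> \<eta>' \<zeta>'. (\<forall>i\<in>F. \<eta> i = \<eta>' i \<and> \<zeta> i = \<zeta>' i) \<longrightarrow>
        \<phi> (\<eta>, \<zeta>) = \<phi> (\<eta>', \<zeta>')))"

text \<open>For cylinder functions only finitely many terms of the sums below are non-zero.\<close>

definition generator ::
    "(int \<Rightarrow> int \<Rightarrow> real) \<Rightarrow> (int \<Rightarrow> int \<Rightarrow> real) \<Rightarrow> (config \<Rightarrow> real) \<Rightarrow> config \<Rightarrow> real" where
  "generator p q \<phi> \<omega> =
     (\<Sum>\<^sub>\<infinity>i. p (\<omega> i) (\<omega> (i + 1)) * (\<phi> (move_up i \<omega>) - \<phi> \<omega>)) +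
     (\<Sum>\<^sub>\<infinity>i. q (\<omega> i) (\<omega> (i + 1)) * (\<phi> (move_down i \<omega>) - \<phi> \<omega>))"

definition coupling_generator ::
    "(int \<Rightarrow> int \<Rightarrow> real) \<Rightarrow> (int \<Rightarrow> int \<Rightarrow> real) \<Rightarrow>
     (config \<times> config \<Rightarrow> real) \<Rightarrow> config \<times> config \<Rightarrow> real" where
  "coupling_generator p q \<phi> = (\<lambda>(\<eta>, \<zeta>).
     (\<Sum>\<^sub>\<infinity>i.
        (p (\<zeta> i) (\<zeta> (i+1)) - p (\<eta> i) (\<zeta> (i+1))) * (\<phi> (\<eta>, move_up i \<zeta>) - \<phi> (\<eta>, \<zeta>)) +
        (p (\<eta> i) (\<eta> (i+1)) - p (\<eta> i) (\<zeta> (i+1))) * (\<phi> (move_up i \<eta>, \<zeta>) - \<phi> (\<eta>, \<zeta>)) +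
        p (\<eta> i) (\<zeta> (i+1)) * (\<phi> (move_up i \<eta>, move_up i \<zeta>) - \<phi> (\<eta>, \<zeta>))) +
     (\<Sum>\<^sub>\<infinity>i.
        (q (\<zeta> i) (\<zeta> (i+1)) - q (\<zeta> i) (\<eta> (i+1))) * (\<phi> (\<eta>, move_down i \<zeta>) - \<phi> (\<eta>, \<zeta>)) +
        (q (\<eta> i) (\<eta> (i+1)) - q (\<zeta> i) (\<eta> (i+1))) * (\<phi> (move_down i \<eta>, \<zeta>) - \<phi> (\<eta>, \<zeta>)) +
        q (\<zeta> i) (\<eta> (i+1)) * (\<phi> (move_down i \<eta>, move_down i \<zeta>) - \<phi> (\<eta>, \<zeta>))))"

section \<open>Markov semigroups and Markov processes\<close>

text \<open>Markov transition kernels \<^term>\<open>K t x\<close>, \<^term>\<open>t \<ge> 0\<close>, on the measurable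
  part \<^term>\<open>T\<close> of the measurable space \<^term>\<open>S\<close>.\<close>

definition markov_semigroup :: "'s measure \<Rightarrow> 's set \<Rightarrow> (real \<Rightarrow> 's \<Rightarrow> 's measure) \<Rightarrow> bool" where
  "markov_semigroup S T K \<longleftrightarrow>
     T \<in> sets S \<and>
     (\<forall>t\<ge>0. K t \<in> restrict_space S T \<rightarrow>\<^sub>M prob_algebra S) \<and>
     (\<forall>t\<ge>0. \<forall>x\<in>T. AE y in K t x. y \<in> T) \<and>
     (\<forall>x\<in>T. K 0 x = return S x) \<and>
     (\<forall>s\<ge>0. \<forall>t\<ge>0. \<forall>x\<in>T. \<forall>B\<in>sets S.
        emeasure (K (s + t) x) B = (\<integral>\<^sup>+ y. emeasure (K t y) B \<partial>K s x))"

text \<open>The generator acts on the functions in \<^term>\<open>D\<close> by \<^term>\<open>L\<close>: the integrated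
  Kolmogorov forward equation.\<close>

definition has_generator_on ::
    "'s set \<Rightarrow> (real \<Rightarrow> 's \<Rightarrow> 's measure) \<Rightarrow> ('s \<Rightarrow> real) set \<Rightarrow> (('s \<Rightarrow> real) \<Rightarrow> 's \<Rightarrow> real) \<Rightarrow> bool" where
  "has_generator_on T K D L \<longleftrightarrow>
     (\<forall>\<phi>\<in>D. \<forall>x\<in>T. \<forall>t\<ge>0.
        integrable (K t x) (L \<phi>) \<and>
        ((\<lambda>s. \<integral>y. L \<phi> y \<partial>K s x) has_integral ((\<integral>y. \<phi> y \<partial>K t x) - \<phi> x)) {0..t})"

text \<open>Markov property with respect to the natural filtration of \<^term>\<open>X\<close>; the underlying
  measure \<^term>\<open>M\<close> need not be normalised.\<close>

definition markov_process ::
    "'a measure \<Rightarrow> 's measure \<Rightarrow> 's set \<Rightarrow> (real \<Rightarrow> 's \<Rightarrow> 's measure) \<Rightarrow> (real \<Rightarrow> 'a \<Rightarrow> 's) \<Rightarrow> bool" where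
  "markov_process M S T K X \<longleftrightarrow>
     (\<forall>t\<ge>0. X t \<in> M \<rightarrow>\<^sub>M S) \<and>
     (\<forall>t\<ge>0. AE x in M. X t x \<in> T) \<and>
     (\<forall>s\<ge>0. \<forall>t\<ge>0. \<forall>B\<in>sets S.
        \<forall>A\<in>sigma_sets (space M) {X u -` C \<inter> space M | u C. 0 \<le> u \<and> u \<le> s \<and> C \<in> sets S}.
          emeasure M (A \<inter> X (s + t) -` B) = (\<integral>\<^sup>+ x\<in>A. emeasure (K t (X s x)) B \<partial>M))"

section \<open>The dynamics and the basic coupling\<close>

text \<open>\<^term>\<open>T\<close> is the set of tempered configurations.\<close>

locale deposition_dynamics = deposition_rates +
  fixes T :: "config set"
    and K :: "real \<Rightarrow> config \<Rightarrow> config measure"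
  assumes tempered_subset: "T \<subseteq> {\<omega>. \<forall>i. \<omega> i \<in> local_states wmin wmax}"
    and semigroup: "markov_semigroup config_space T K"
    and dynamics_generator:
      "has_generator_on T K {\<phi>. cylinder \<phi> \<and> bounded (range \<phi>)} (generator p q)"
    and tempered_full: "\<And>\<theta>. theta_lower wmin f < ereal \<theta> \<Longrightarrow> ereal \<theta> < theta_upper wmax f \<Longrightarrow>
        AE \<omega> in product_mu wmin wmax f \<theta>. \<omega> \<in> T"
    and stationary: "\<And>\<theta> t B. theta_lower wmin f < ereal \<theta> \<Longrightarrow> ereal \<theta> < theta_upper wmax f \<Longrightarrow>
        0 \<le> t \<Longrightarrow> B \<in> sets config_space \<Longrightarrow>
        (\<integral>\<^sup>+ \<omega>. emeasure (K t \<omega>) B \<partial>product_mu wmin wmax f \<theta>) = emeasure (product_mu wmin wmax f \<theta>) B"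

definition ordered_pairs :: "config set \<Rightarrow> (config \<times> config) set" where
  "ordered_pairs T = {(\<eta>, \<zeta>). \<eta> \<in> T \<and> \<zeta> \<in> T \<and> (\<forall>i. \<eta> i \<le> \<zeta> i)}"

text \<open>The kernels \<^term>\<open>Kc\<close> of the coupled pair: each component is a copy of the process
  with kernels \<^term>\<open>K\<close>, and the joint jump rates are those of the basic coupling.\<close>

locale basic_coupling = deposition_dynamics +
  fixes Kc :: "real \<Rightarrow> config \<times> config \<Rightarrow> (config \<times> config) measure"
  assumes coupling_semigroup:
      "markov_semigroup (config_space \<Otimes>\<^sub>M config_space) (ordered_pairs T) Kc"
    and coupling_marginals: "\<And>\<eta> \<zeta> t. (\<eta>, \<zeta>) \<in> ordered_pairs T \<Longrightarrow> 0 \<le> t \<Longrightarrow>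
        distr (Kc t (\<eta>, \<zeta>)) config_space fst = K t \<eta> \<and>
        distr (Kc t (\<eta>, \<zeta>)) config_space snd = K t \<zeta>"
    and coupling_rates: "has_generator_on (ordered_pairs T) Kc
        {\<phi>. cylinder2 \<phi> \<and> bounded (range \<phi>)} (coupling_generator p q)"

definition add_particle :: "config \<Rightarrow> int \<Rightarrow> config" where
  "add_particle \<omega> i = fun_upd \<omega> i (\<omega> i + 1)"

definition covariance :: "'a measure \<Rightarrow> ('a \<Rightarrow> real) \<Rightarrow> ('a \<Rightarrow> real) \<Rightarrow> real" where
  "covariance M X Y = (\<integral>x. (X x - (\<integral>y. X y \<partial>M)) * (Y x - (\<integral>y. Y y \<partial>M)) \<partial>M)"

end

theory Submission
  imports Defs "HOL-Real_Asymp.Real_Asymp"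
begin

text \<open>The stationary marginal \<open>\<mu>\<close> has a finite second moment: since \<open>f\<close> is monotone and
  \<open>\<theta>\<close> lies strictly between the limits of \<open>ln (f z)\<close>, the weights decay geometrically in every
  unbounded direction. Write \<open>m\<close> for the mean of
  \<open>\<mu>\<close> and \<open>g z = z - m\<close>. Splitting the covariance according to the value of \<open>\<omega>\<^sub>0(0)\<close> gives

  \<open>Cov(\<omega>\<^sub>n(t), \<omega>\<^sub>0(0)) = \<Sum>\<^sub>z g z * \<mu> z * a z\<close>, where \<open>a z = E(\<omega>\<^sub>n(t) | \<omega>\<^sub>0(0) = z)\<close>.

  As \<open>g * \<mu>\<close> sums to zero, summation by parts turns this into
  \<open>\<Sum>\<^sub>w (a (w+1) - a w) * \<Sum>\<^sub>z\<^sub>>\<^sub>w g z * \<mu> z\<close>. The increment of \<open>a\<close> is where the second class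
  particle enters. Under the product measure, conditioning on \<open>\<omega>\<^sub>0(0) = w\<close> and then adding a particle
  at the origin has the same effect as conditioning on \<open>\<omega>\<^sub>0(0) = w + 1\<close>. Hence, given
  \<open>\<omega>\<^sub>0(0) = w\<close>, the second component of the coupled pair at time \<open>t\<close> has the law of the process
  given \<open>\<omega>\<^sub>0(0) = w + 1\<close>. Since the two components differ by the indicator of the site
  \<open>Q(t)\<close>, it follows that \<open>a (w+1) - a w = P(Q(t) = n | \<omega>\<^sub>0(0) = w)\<close>, and resumming over
  \<open>w\<close> yields the expectation on the right-hand side.

  The carrying lemmas are \<open>weight_summable\<close> (moments), \<open>summation_by_parts\<close>,
  \<open>product_shift\<close> (tilting the product measure by one particle), \<open>coupled_law\<close> and
  \<open>levels_proportional\<close> (transport of that identity to time \<open>t\<close>), and \<open>level_increment\<close>.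
  Only the laws of the process at time \<open>t\<close> and their dependence on the value at the origin enter, so the
  argument compares measures and avoids conditional expectations of the unbounded function
  \<open>\<omega>\<^sub>n(t)\<close>.

  Non-negativity of the inner sum holds because \<open>g\<close> changes sign only once, from negative to positive,
  and has mean zero: every upper tail of \<open>g * \<mu>\<close> is either a sum of non-negative terms or the negative
  of a sum of non-positive ones.\<close>

section \<open>Monotonicity of the rate function\<close>

lemma local_states_convex:
  assumes "x \<in> local_states a b" "z \<in> local_states a b" "x \<le> y" "y \<le> z"
  shows "y \<in> local_states a b"
  using assms by (cases a; cases b) (auto simp: local_states_def)

lemma local_states_pred:
  assumes "z \<in> local_states a b" "Fin z \<noteq> a"
  shows "z - 1 \<in> local_states a b" "Fin (z - 1) \<noteq> b"
  using assms by (cases a; cases b; auto simp: local_states_def)+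

text \<open>The quotient of consecutive polynomial factors tends to \<open>1\<close>, so the product eventually decays
  with the ratio \<open>(1 + r) / 2\<close>, which is still smaller than \<open>1\<close>.\<close>

lemma summable_square_times_geometric:
  fixes u :: "nat \<Rightarrow> real"
  assumes pos: "\<And>n. 0 \<le> u n" and r: "0 \<le> r" "r < 1"
    and ratio: "\<And>n. N \<le> n \<Longrightarrow> u (Suc n) \<le> r * u n"
  shows "summable (\<lambda>n. (1 + real n)\<^sup>2 * u n)"
proof -
  define c where "c = (r + 1) / 2"
  have "((\<lambda>n. ((2 + real n) / (1 + real n))\<^sup>2 * r) \<longlongrightarrow> 1 * r) sequentially"
    by (rule tendsto_mult_right) real_asymp
  moreover have "1 * r < c" "c < 1" using r by (auto simp: c_def)
  ultimately have "\<forall>\<^sub>F n in sequentially. ((2 + real n) / (1 + real n))\<^sup>2 * r < c"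
    by (simp add: order_tendsto_iff)
  then obtain N' where N': "\<And>n. N' \<le> n \<Longrightarrow> ((2 + real n) / (1 + real n))\<^sup>2 * r < c"
    by (auto simp: eventually_sequentially)
  show ?thesis
  proof (rule summable_ratio_test[OF \<open>c < 1\<close>, of "max N N'"])
    fix n assume n: "max N N' \<le> n"
    have "(2 + real n)\<^sup>2 * r = (((2 + real n) / (1 + real n))\<^sup>2 * r) * (1 + real n)\<^sup>2"
      by (simp add: power_divide)
    also have "\<dots> \<le> c * (1 + real n)\<^sup>2"
      using N'[of n] n by (intro mult_right_mono) auto
    finally have *: "(2 + real n)\<^sup>2 * r \<le> c * (1 + real n)\<^sup>2" .
    have "(2 + real n)\<^sup>2 * u (Suc n) \<le> (2 + real n)\<^sup>2 * (r * u n)"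
      using ratio[of n] n by (intro mult_left_mono) auto
    also have "\<dots> = (2 + real n)\<^sup>2 * r * u n" by simp
    also have "\<dots> \<le> c * (1 + real n)\<^sup>2 * u n"
      using * pos by (intro mult_right_mono)
    finally show "norm ((1 + real (Suc n))\<^sup>2 * u (Suc n)) \<le> c * norm ((1 + real n)\<^sup>2 * u n)"
      using pos by (simp add: mult.assoc)
  qed
qed

context deposition_rates
begin

abbreviation "states \<equiv> local_states wmin wmax"

lemma zero_in_states: "0 \<in> states"
  using wmin_le wmax_ge by (cases wmin; cases wmax) (auto simp: local_states_def)

text \<open>Strictly above \<^term>\<open>wmin\<close> at least one of the two rates that lower the value
  \<^term>\<open>z\<close> in favour of a neighbour at \<^term>\<open>z - 1\<close> is non-zero, and both carry the
  factor \<^term>\<open>f z\<close>.\<close>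

lemma f_pos:
  assumes z: "z \<in> states" "Fin z \<noteq> wmin"
  shows "0 < f z"
proof -
  have z': "z - 1 \<in> states" "Fin (z - 1) \<noteq> wmax"
    using local_states_pred[OF z] by auto
  obtain sp sq :: "int \<Rightarrow> int \<Rightarrow> real" where
    s: "\<forall>y\<in>states. \<forall>z\<in>states. p y z = sp y (z + 1) * f y \<and> q y z = sq (y + 1) z * f z"
    using product_form by blast
  have "p z (z - 1) \<noteq> 0 \<or> q (z - 1) z \<noteq> 0"
    using non_degenerate z z' unfolding Let_def by blast
  hence "f z \<noteq> 0" using s z z' by auto
  with f_nonneg[OF z(1)] show ?thesis by simp
qed

text \<open>The two rates \<^term>\<open>p z z\<close> and \<^term>\<open>p (z + 1) (z - 1)\<close> have the same symmetric
  factor, so their ratio is that of the values of \<^term>\<open>f\<close>, while attractivity compares them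
  through the intermediate rate \<^term>\<open>p z (z - 1)\<close>. The argument for \<^term>\<open>q\<close> is the mirror
  image; it is required for the processes in which \<^term>\<open>p\<close> vanishes.\<close>

lemma f_mono_step:
  assumes z: "z \<in> states" "z + 1 \<in> states"
  shows "f z \<le> f (z + 1)"
proof (cases "Fin z = wmin")
  case True
  thus ?thesis using f_boundary f_nonneg[OF z(2)] by simp
next
  case False
  have z': "z - 1 \<in> states" using local_states_pred[OF z(1) False] by auto
  have zmax: "Fin z \<noteq> wmax" using z(2) by (cases wmax) (auto simp: local_states_def)
  obtain sp sq :: "int \<Rightarrow> int \<Rightarrow> real" where
    sym: "\<And>y z. sp y z = sp z y" "\<And>y z. sq y z = sq z y" and
    s: "\<forall>y\<in>states. \<forall>z\<in>states. p y z = sp y (z + 1) * f y \<and> q y z = sq (y + 1) z * f z"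
    using product_form by blast
  have step: "f z \<le> f (z + 1)" if "s * f z \<le> s * f (z + 1)" "0 < s * f z" for s
    using that f_pos[OF z(1) False] by (simp add: zero_less_mult_iff)
  consider "p z z \<noteq> 0" | "q z z \<noteq> 0"
    using non_degenerate z(1) False zmax unfolding Let_def by blast
  thus ?thesis
  proof cases
    case 1
    have "p z z \<le> p z (z - 1)" using attractive[of z "z - 1"] z z' by simp
    also have "\<dots> \<le> p (z + 1) (z - 1)" using attractive[of "z - 1" z] z z' by simp
    finally have "sp z (z + 1) * f z \<le> sp z (z + 1) * f (z + 1)"
      using s z z' sym(1)[of z "z + 1"] by auto
    moreover have "0 < sp z (z + 1) * f z"
      using 1 s z(1) rates_nonneg[OF z(1) z(1)] by (auto simp: less_le)
    ultimately show ?thesis by (rule step)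
  next
    case 2
    have "q z z \<le> q (z - 1) z" using attractive[of z "z - 1"] z z' by simp
    also have "\<dots> \<le> q (z - 1) (z + 1)" using attractive[of "z - 1" z] z z' by simp
    finally have "sq z (z + 1) * f z \<le> sq z (z + 1) * f (z + 1)"
      using s z z' sym(2)[of z "z + 1"] by auto
    moreover have "0 < sq z (z + 1) * f z"
      using 2 s z(1) rates_nonneg[OF z(1) z(1)] sym(2)[of z "z + 1"] by (auto simp: less_le)
    ultimately show ?thesis by (rule step)
  qed
qed

section \<open>Moments of the stationary marginal\<close>

text \<open>All factors of the generalised factorial lie strictly above \<^term>\<open>wmin\<close>, where
  \<^term>\<open>f\<close> is positive.\<close>

lemma f_fact_pos:
  assumes "z \<in> states"
  shows "0 < f_fact f z"
proof -
  have pos: "0 < f y" if "min z 0 < y" "y \<le> max z 0" for y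
  proof (rule f_pos)
    have ends: "min z 0 \<in> states" "max z 0 \<in> states"
      using assms zero_in_states by (simp_all add: min_def max_def)
    show "y \<in> states"
      by (rule local_states_convex[OF ends]) (use that in auto)
    from ends(1) show "Fin y \<noteq> wmin"
      using that by (cases wmin) (auto simp: local_states_def)
  qed
  show ?thesis
    unfolding f_fact_def by (auto intro!: prod_pos pos)
qed

lemma f_fact_succ:
  assumes z: "z \<in> states" "z + 1 \<in> states"
  shows "f_fact f (z + 1) = f_fact f z * f (z + 1)"
proof (cases "0 \<le> z")
  case True
  have "{1..z + 1} = insert (z + 1) {1..z}" using True by auto
  thus ?thesis using True by (auto simp: f_fact_def)
next
  case False
  have "Fin (z + 1) \<noteq> wmin" using z(1) by (cases wmin) (auto simp: local_states_def)
  hence "f (z + 1) \<noteq> 0" using f_pos[OF z(2)] by simp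
  moreover have "{z + 1..0} = insert (z + 1) {2 + z..0}" using False by auto
  ultimately show ?thesis using False by (auto simp: f_fact_def)
qed

text \<open>Monotonicity of \<^term>\<open>f\<close> turns the limit in the definition of \<^const>\<open>theta_upper\<close> into a
  supremum, so some term of the sequence exceeds any \<open>\<theta>\<close> below it. The sequence is shifted by one
  because \<^term>\<open>f 0\<close> may vanish.\<close>

lemma theta_upper_witness:
  assumes "wmax = Pinf" "ereal \<theta> < theta_upper wmax f"
  obtains N where "1 \<le> N" "\<theta> < ln (f (int N))"
proof -
  define X where "X n = ereal (ln (f (int (Suc n))))" for n
  have st: "int n \<in> states" for n
    using zero_in_states assms(1) by (cases wmin) (auto simp: local_states_def)
  have pos: "0 < f (int (Suc n))" for n
    using wmin_le by (intro f_pos st) (cases wmin; auto)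
  have "incseq X"
  proof (rule incseq_SucI)
    fix n
    show "X n \<le> X (Suc n)"
      using f_mono_step[OF st[of "Suc n"]] st[of "Suc (Suc n)"] pos[of n] pos[of "Suc n"]
      by (simp add: X_def algebra_simps)
  qed
  hence "X \<longlonglongrightarrow> (SUP n. X n)" by (rule LIMSEQ_SUP)
  hence "(\<lambda>n. ereal (ln (f (int n)))) \<longlonglongrightarrow> (SUP n. X n)"
    unfolding X_def by (rule LIMSEQ_imp_Suc)
  hence "theta_upper wmax f = (SUP n. X n)"
    using assms(1) by (simp add: theta_upper_def limI)
  with assms(2) obtain n where "ereal \<theta> < X n" by (auto simp: less_SUP_iff)
  thus ?thesis using that[of "Suc n"] by (simp add: X_def)
qed

lemma theta_lower_witness:
  assumes "wmin = Minf" "theta_lower wmin f < ereal \<theta>"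
  obtains N where "ln (f (- int N)) < \<theta>"
proof -
  define X where "X n = ereal (ln (f (- int n)))" for n
  have st: "- int n \<in> states" for n
    using zero_in_states assms(1) by (cases wmax) (auto simp: local_states_def)
  have pos: "0 < f (- int n)" for n
    using assms(1) by (intro f_pos st) auto
  have "decseq X"
  proof (rule decseq_SucI)
    fix n
    show "X (Suc n) \<le> X n"
      using f_mono_step[OF st[of "Suc n"]] st[of n] pos[of n] pos[of "Suc n"]
      by (simp add: X_def)
  qed
  hence "X \<longlonglongrightarrow> (INF n. X n)" by (rule LIMSEQ_INF)
  hence "theta_lower wmin f = (INF n. X n)"
    using assms(1) unfolding X_def by (simp add: theta_lower_def limI)
  with assms(2) obtain n where "X n < ereal \<theta>" by (auto simp: INF_less_iff)
  thus ?thesis using that[of n] by (simp add: X_def)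
qed

lemma f_mono:
  assumes "x \<in> states" "y \<in> states" "x \<le> y"
  shows "f x \<le> f y"
  using assms(3,2)
proof (induction y rule: int_ge_induct)
  case base
  show ?case by simp
next
  case (step y)
  have "y \<in> states" using local_states_convex[OF assms(1) step.prems, of y] step.hyps by simp
  thus ?case using step f_mono_step[of y] by force
qed

text \<open>Far from the origin, in an unbounded direction, consecutive weights have ratio at most
  \<open>exp \<theta> / f N < 1\<close> on the right and \<open>f (- N) / exp \<theta> < 1\<close> on the left, for a suitable
  \<open>N\<close> on each side. The weight
  \<open>(1 + \<bar>z\<bar>)\<^sup>2\<close> dominates the constant function, the modulus and the square simultaneously.\<close>

lemma weight_summable:
  assumes theta: "theta_lower wmin f < ereal \<theta>" "ereal \<theta> < theta_upper wmax f"
  shows "(\<lambda>z. (1 + \<bar>real_of_int z\<bar>)\<^sup>2 * (exp (\<theta> * real_of_int z) / f_fact f z)) summable_on states"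
proof -
  define W where "W z = exp (\<theta> * real_of_int z) / f_fact f z" for z
  have W_nonneg: "0 \<le> W z" if "z \<in> states" for z
    using f_fact_pos[OF that] by (simp add: W_def)
  have W_step: "W (z + 1) = W z * (exp \<theta> / f (z + 1))" if "z \<in> states" "z + 1 \<in> states" for z
    using f_fact_succ[OF that] by (simp add: W_def exp_add algebra_simps)
  have up: "(\<lambda>z. (1 + \<bar>real_of_int z\<bar>)\<^sup>2 * W z) summable_on {z \<in> states. 0 \<le> z}"
  proof (cases "wmax = Pinf")
    case False
    then obtain b where "wmax = Fin b" using wmax_ge by (cases wmax) auto
    hence "{z \<in> states. 0 \<le> z} \<subseteq> {0..b}" by (auto simp: local_states_def)
    hence "finite {z \<in> states. 0 \<le> z}"
      by (rule finite_subset) simp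
    thus ?thesis by (rule summable_on_finite)
  next
    case True
    have st: "int n \<in> states" for n
      using zero_in_states True by (cases wmin) (auto simp: local_states_def)
    obtain N where N: "1 \<le> N" "\<theta> < ln (f (int N))"
      using theta_upper_witness[OF True theta(2)] .
    have fN: "0 < f (int N)"
      using N(1) wmin_le by (intro f_pos st) (cases wmin; auto)
    define r where "r = exp \<theta> / f (int N)"
    have "exp \<theta> < f (int N)" using N(2) fN by (metis exp_less_cancel_iff exp_ln)
    hence r: "0 \<le> r" "r < 1" using fN by (auto simp: r_def)
    have "summable (\<lambda>n. (1 + real n)\<^sup>2 * W (int n))"
    proof (rule summable_square_times_geometric[OF W_nonneg[OF st] r, of N])
      fix n assume n: "N \<le> n"
      have "exp \<theta> / f (int n + 1) \<le> r"
        unfolding r_def using f_mono[OF st[of N] st[of "Suc n"]] fN n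
        by (intro divide_left_mono mult_pos_pos) (auto simp: algebra_simps)
      hence "exp \<theta> / f (int n + 1) * W (int n) \<le> r * W (int n)"
        using W_nonneg[OF st[of n]] by (rule mult_right_mono)
      thus "W (int (Suc n)) \<le> r * W (int n)"
        using W_step[OF st[of n]] st[of "Suc n"] by (simp add: add.commute mult.commute)
    qed
    hence "(\<lambda>n. (1 + real n)\<^sup>2 * W (int n)) summable_on UNIV"
      using W_nonneg[OF st] by (intro summable_nonneg_imp_summable_on) auto
    hence "(\<lambda>z. (1 + \<bar>real_of_int z\<bar>)\<^sup>2 * W z) summable_on range int"
      by (subst summable_on_reindex) (auto simp: o_def)
    moreover have "{z \<in> states. 0 \<le> z} = range int"
    proof -
      have "z \<in> range int" if "0 \<le> z" for z
        using that by (intro image_eqI[of _ _ "nat z"]) auto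
      thus ?thesis using st by auto
    qed
    ultimately show ?thesis by simp
  qed
  have down: "(\<lambda>z. (1 + \<bar>real_of_int z\<bar>)\<^sup>2 * W z) summable_on {z \<in> states. z \<le> 0}"
  proof (cases "wmin = Minf")
    case False
    then obtain a where "wmin = Fin a" using wmin_le by (cases wmin) auto
    hence "{z \<in> states. z \<le> 0} \<subseteq> {a..0}" by (auto simp: local_states_def)
    hence "finite {z \<in> states. z \<le> 0}"
      by (rule finite_subset) simp
    thus ?thesis by (rule summable_on_finite)
  next
    case True
    have st: "- int n \<in> states" for n
      using zero_in_states True by (cases wmax) (auto simp: local_states_def)
    have pos: "0 < f (- int n)" for n
      using True by (intro f_pos st) auto
    obtain N where N: "ln (f (- int N)) < \<theta>"
      using theta_lower_witness[OF True theta(1)] .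
    define r where "r = f (- int N) / exp \<theta>"
    have "f (- int N) < exp \<theta>" using N pos[of N] by (metis exp_less_cancel_iff exp_ln)
    hence r: "0 \<le> r" "r < 1" using pos[of N] by (auto simp: r_def)
    have "summable (\<lambda>n. (1 + real n)\<^sup>2 * W (- int n))"
    proof (rule summable_square_times_geometric[OF W_nonneg[OF st] r, of N])
      fix n assume n: "N \<le> n"
      have "W (- int n) = W (- int (Suc n)) * (exp \<theta> / f (- int n))"
        using W_step[OF st[of "Suc n"]] st[of n] by simp
      hence "W (- int (Suc n)) = f (- int n) / exp \<theta> * W (- int n)"
        using pos[of n] by (simp add: field_simps)
      also have "\<dots> \<le> r * W (- int n)"
        unfolding r_def using f_mono[OF st[of n] st[of N]] n W_nonneg[OF st[of n]]
        by (intro mult_right_mono divide_right_mono) auto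
      finally show "W (- int (Suc n)) \<le> r * W (- int n)" .
    qed
    hence "(\<lambda>n. (1 + real n)\<^sup>2 * W (- int n)) summable_on UNIV"
      using W_nonneg[OF st] by (intro summable_nonneg_imp_summable_on) auto
    hence "(\<lambda>z. (1 + \<bar>real_of_int z\<bar>)\<^sup>2 * W z) summable_on range (\<lambda>n. - int n)"
      by (subst summable_on_reindex) (auto simp: o_def inj_on_def)
    moreover have "{z \<in> states. z \<le> 0} = range (\<lambda>n. - int n)"
    proof -
      have "z \<in> range (\<lambda>n. - int n)" if "z \<le> 0" for z
        using that by (intro image_eqI[of _ _ "nat (- z)"]) auto
      thus ?thesis using st by auto
    qed
    ultimately show ?thesis by simp
  qed
  have "(\<lambda>z. (1 + \<bar>real_of_int z\<bar>)\<^sup>2 * W z) summable_on {z \<in> states. z < 0}"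
    by (rule summable_on_subset_banach[OF down]) auto
  hence "(\<lambda>z. (1 + \<bar>real_of_int z\<bar>)\<^sup>2 * W z) summable_on
      ({z \<in> states. 0 \<le> z} \<union> {z \<in> states. z < 0})"
    by (rule summable_on_Un_disjoint[OF up]) auto
  also have "{z \<in> states. 0 \<le> z} \<union> {z \<in> states. z < 0} = states" by auto
  finally show ?thesis by (simp add: W_def)
qed

end

section \<open>Sums and integrals over the integers\<close>

text \<open>The enumeration \<^const>\<open>int_decode\<close> of the integers reduces the claim to termwise integration of
  a series indexed by the natural numbers; each point contributes to exactly one term.\<close>

lemma has_sum_integral_over_levels:
  fixes h :: "'a \<Rightarrow> real" and U :: "'a \<Rightarrow> int"
  assumes U[measurable]: "U \<in> M \<rightarrow>\<^sub>M count_space UNIV" and h: "integrable M h"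
  shows "((\<lambda>z. \<integral>x. indicator {x. U x = z} x * h x \<partial>M) has_sum (\<integral>x. h x \<partial>M)) UNIV"
proof -
  note [measurable] = borel_measurable_integrable[OF h]
  define k where "k i x = indicator {x. U x = int_decode i} x * h x" for i x
  have k_int: "integrable M (k i)" for i
    unfolding k_def by (rule Bochner_Integration.integrable_bound[OF h]) (auto simp: indicator_def)
  have k_other: "k i x = 0" if "i \<noteq> int_encode (U x)" for i x
    using that by (auto simp: k_def indicator_def)
  have k_sums: "(\<lambda>i. k i x) sums h x" for x
    using sums_finite[of "{int_encode (U x)}" "\<lambda>i. k i x"] k_other by (simp add: k_def)
  have k_norm: "summable (\<lambda>i. norm (k i x))" for x
    by (rule summable_finite[of "{int_encode (U x)}"]) (auto simp: k_other)
  have norm_int: "summable (\<lambda>i. \<integral>x. norm (k i x) \<partial>M)"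
  proof (rule summableI_nonneg_bounded)
    fix n
    have "(\<Sum>i<n. \<integral>x. norm (k i x) \<partial>M) = (\<integral>x. (\<Sum>i<n. norm (k i x)) \<partial>M)"
      using k_int by (intro Bochner_Integration.integral_sum[symmetric]) auto
    also have "\<dots> \<le> (\<integral>x. norm (h x) \<partial>M)"
    proof (intro integral_mono)
      fix x
      have "(\<lambda>i. norm (k i x)) sums norm (h x)"
        using sums_finite[of "{int_encode (U x)}" "\<lambda>i. norm (k i x)"] k_other by (simp add: k_def)
      thus "(\<Sum>i<n. norm (k i x)) \<le> norm (h x)"
        using sum_le_suminf[OF k_norm[of x], of "{..<n}"] by (simp add: sums_iff)
    qed (use k_int h in auto)
    finally show "(\<Sum>i<n. \<integral>x. norm (k i x) \<partial>M) \<le> (\<integral>x. norm (h x) \<partial>M)" .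
  qed simp
  have "(\<lambda>i. \<integral>x. k i x \<partial>M) sums (\<integral>x. (\<Sum>i. k i x) \<partial>M)"
    using k_int k_norm norm_int by (intro sums_integral) auto
  also have "(\<lambda>x. \<Sum>i. k i x) = h"
    using k_sums by (simp add: sums_iff fun_eq_iff)
  finally have "(\<lambda>i. \<integral>x. k i x \<partial>M) sums (\<integral>x. h x \<partial>M)" .
  moreover have "summable (\<lambda>i. norm (\<integral>x. k i x \<partial>M))"
    by (rule summable_comparison_test'[OF norm_int, of 0]) (simp add: integral_norm_bound)
  ultimately have "((\<lambda>i. \<integral>x. k i x \<partial>M) has_sum (\<integral>x. h x \<partial>M)) UNIV"
    by (intro norm_summable_imp_has_sum)
  thus ?thesis
    unfolding k_def by (subst (asm) has_sum_reindex_bij_betw[OF bij_int_decode])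
qed

lemma count_space_real:
  fixes \<phi> :: "'a \<Rightarrow> real"
  assumes "\<phi> summable_on UNIV"
  shows "integrable (count_space UNIV) \<phi>" "(\<integral>z. \<phi> z \<partial>count_space UNIV) = infsum \<phi> UNIV"
proof -
  have *: "Infinite_Set_Sum.abs_summable_on \<phi> UNIV"
    using assms summable_on_iff_abs_summable_on_real abs_summable_equivalent by blast
  show "integrable (count_space UNIV) \<phi>"
    using * by (simp add: Infinite_Set_Sum.abs_summable_on_def)
  show "(\<integral>z. \<phi> z \<partial>count_space UNIV) = infsum \<phi> UNIV"
    using infsetsum_infsum[OF *] by (simp add: infsetsum_def)
qed

lemma nn_integral_count_space_has_sum:
  fixes \<phi> :: "'a \<Rightarrow> real"
  assumes "\<And>z. 0 \<le> \<phi> z" "(\<phi> has_sum s) UNIV"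
  shows "(\<integral>\<^sup>+z. ennreal (\<phi> z) \<partial>count_space UNIV) = ennreal s"
  using count_space_real[of \<phi>] assms
  by (subst nn_integral_eq_integral) (auto simp: has_sum_iff)

lemma integrable_pmf_summable:
  fixes \<phi> :: "'a \<Rightarrow> real"
  assumes "(\<lambda>z. pmf \<nu> z * \<phi> z) summable_on UNIV"
  shows "integrable (measure_pmf \<nu>) \<phi>"
    and "(\<integral>z. \<phi> z \<partial>measure_pmf \<nu>) = (\<Sum>\<^sub>\<infinity>z. pmf \<nu> z * \<phi> z)"
  using count_space_real[OF assms]
  by (simp_all add: measure_pmf_eq_density integrable_real_density integral_real_density)

lemma infsum_tails_opposite:
  fixes h :: "int \<Rightarrow> real"
  assumes "(h has_sum 0) UNIV"
  shows "infsum h {w<..} = - infsum h {..w}"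
proof -
  have s: "h summable_on UNIV" using assms by (auto simp: summable_on_def)
  have "{w<..} \<union> {..w} = UNIV" by auto
  moreover have "infsum h ({w<..} \<union> {..w}) = infsum h {w<..} + infsum h {..w}"
    using s by (intro infsum_Un_disjoint) (auto intro: summable_on_subset_banach)
  ultimately have "0 = infsum h {w<..} + infsum h {..w}"
    using infsumI[OF assms] by simp
  thus ?thesis by simp
qed

text \<open>If \<^term>\<open>w\<close> is at least \<^term>\<open>m\<close>, every term of the tail is non-negative. Otherwise
  every term of the complementary sum over \<open>{..w}\<close> is non-positive, and the two sums cancel.\<close>

lemma centred_tail_nonneg:
  fixes u :: "int \<Rightarrow> real"
  assumes u: "\<And>z. 0 \<le> u z" and zero: "((\<lambda>z. (real_of_int z - m) * u z) has_sum 0) UNIV"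
  shows "0 \<le> (\<Sum>\<^sub>\<infinity>z\<in>{w<..}. (real_of_int z - m) * u z)"
proof (cases "m \<le> real_of_int w")
  case True
  thus ?thesis using u by (intro infsum_nonneg mult_nonneg_nonneg) auto
next
  case False
  have "0 \<le> (\<Sum>\<^sub>\<infinity>z\<in>{..w}. - ((real_of_int z - m) * u z))"
    using u False by (intro infsum_nonneg) (auto intro: mult_nonpos_nonneg)
  thus ?thesis by (simp add: infsum_tails_opposite[OF zero] infsum_uminus)
qed

section \<open>Summation by parts\<close>

text \<open>The oriented indicator that the path from \<open>0\<close> to \<^term>\<open>z\<close> uses the edge between
  \<^term>\<open>w\<close> and \<^term>\<open>w + 1\<close>.\<close>

definition crossing :: "int \<Rightarrow> int \<Rightarrow> real" where
  "crossing w z = (if 0 \<le> w \<and> w < z then 1 else if z \<le> w \<and> w < 0 then - 1 else 0)"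

text \<open>The discrete integral of \<^term>\<open>D\<close> from \<open>0\<close> to \<^term>\<open>z\<close>, for either order of
  the end points.\<close>

definition signed_sum :: "(int \<Rightarrow> real) \<Rightarrow> int \<Rightarrow> real" where
  "signed_sum D z = sum D {0..<z} - sum D {z..<0}"

lemma has_sum_crossing:
  fixes D :: "int \<Rightarrow> real"
  shows "((\<lambda>w. D w * crossing w z) has_sum signed_sum D z) UNIV"
    and "((\<lambda>w. \<bar>D w * crossing w z\<bar>) has_sum \<bar>signed_sum (\<lambda>w. \<bar>D w\<bar>) z\<bar>) UNIV"
proof -
  have neutral: "(k has_sum sum k ({0..<z} \<union> {z..<0})) UNIV"
    if "\<And>w. w \<notin> {0..<z} \<union> {z..<0} \<Longrightarrow> k w = 0" for k :: "int \<Rightarrow> real"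
    using that by (subst has_sum_cong_neutral[of "{0..<z} \<union> {z..<0}" UNIV k k]) (auto intro!: has_sum_finite)
  have split: "sum k ({0..<z} \<union> {z..<0}) = sum k {0..<z} + sum k {z..<0}" for k :: "int \<Rightarrow> real"
    by (intro sum.union_disjoint) auto
  have 1: "sum (\<lambda>w. D w * crossing w z) ({0..<z} \<union> {z..<0}) = signed_sum D z"
    unfolding split signed_sum_def by (simp add: crossing_def sum_negf)
  have "((\<lambda>w. D w * crossing w z) has_sum sum (\<lambda>w. D w * crossing w z) ({0..<z} \<union> {z..<0})) UNIV"
    by (rule neutral) (auto simp: crossing_def)
  thus "((\<lambda>w. D w * crossing w z) has_sum signed_sum D z) UNIV" by (simp only: 1)
  have "0 \<le> sum (\<lambda>w. \<bar>D w\<bar>) A" for A by (simp add: sum_nonneg)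
  hence 2: "sum (\<lambda>w. \<bar>D w * crossing w z\<bar>) ({0..<z} \<union> {z..<0}) = \<bar>signed_sum (\<lambda>w. \<bar>D w\<bar>) z\<bar>"
    unfolding split signed_sum_def by (cases "0 \<le> z") (simp_all add: crossing_def)
  have "((\<lambda>w. \<bar>D w * crossing w z\<bar>) has_sum sum (\<lambda>w. \<bar>D w * crossing w z\<bar>) ({0..<z} \<union> {z..<0})) UNIV"
    by (rule neutral) (auto simp: crossing_def)
  thus "((\<lambda>w. \<bar>D w * crossing w z\<bar>) has_sum \<bar>signed_sum (\<lambda>w. \<bar>D w\<bar>) z\<bar>) UNIV" by (simp only: 2)
qed

lemma signed_sum_bound:
  assumes "\<And>w. \<bar>D w\<bar> \<le> 1"
  shows "\<bar>signed_sum (\<lambda>w. \<bar>D w\<bar>) z\<bar> \<le> \<bar>real_of_int z\<bar>"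
proof -
  have "0 \<le> sum (\<lambda>w. \<bar>D w\<bar>) A" for A by (simp add: sum_nonneg)
  moreover have "sum (\<lambda>w. \<bar>D w\<bar>) {a..<b} \<le> of_int (max 0 (b - a))" for a b
    using sum_mono[of "{a..<b}" "\<lambda>w. \<bar>D w\<bar>" "\<lambda>_. 1"] assms by simp
  from this[of 0 z] this[of z 0] show ?thesis
    using calculation[of "{0..<z}"] calculation[of "{z..<0}"]
    by (cases "0 \<le> z") (simp_all add: signed_sum_def)
qed

text \<open>Telescoping along the path from \<open>0\<close> to \<^term>\<open>z\<close>, which convexity keeps inside
  \<^term>\<open>I\<close>.\<close>

lemma signed_sum_increments:
  assumes convex: "\<And>x y z. x \<in> I \<Longrightarrow> z \<in> I \<Longrightarrow> x \<le> y \<Longrightarrow> y \<le> z \<Longrightarrow> y \<in> I"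
    and zero: "0 \<in> I" and z: "z \<in> I"
    and incr: "\<And>w. w \<in> I \<Longrightarrow> w + 1 \<in> I \<Longrightarrow> A (w + 1) - A w = D w"
  shows "signed_sum D z = A z - A 0"
proof (cases "0 \<le> z")
  case True
  thus ?thesis using z
  proof (induction z rule: int_ge_induct)
    case base
    show ?case by (simp add: signed_sum_def)
  next
    case (step z)
    have "z \<in> I" using convex[OF zero step.prems] step.hyps by simp
    moreover have "{0..<z + 1} = insert z {0..<z}" using step.hyps by auto
    ultimately show ?case
      using step incr[of z] by (simp add: signed_sum_def)
  qed
next
  case False
  hence "z \<le> 0" by simp
  thus ?thesis using z
  proof (induction z rule: int_le_induct)
    case base
    show ?case by (simp add: signed_sum_def)
  next
    case (step z)
    have "z \<in> I" using convex[OF step.prems zero] step.hyps by simp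
    moreover have "{z - 1..<0} = insert (z - 1) {z..<0}" using step.hyps by auto
    ultimately show ?case
      using step incr[of "z - 1"] by (simp add: signed_sum_def)
  qed
qed

text \<open>Both sides are iterated sums of \<open>D w * crossing w z * h z\<close>. The sum of the moduli over
  \<open>w\<close> is at most \<open>\<bar>z\<bar> * \<bar>h z\<bar>\<close>, so the first moment condition permits the exchange. For
  negative \<open>w\<close> the sum over \<open>z\<close> is the negative of a lower tail of \<^term>\<open>h\<close>; this is
  the upper tail again because \<^term>\<open>h\<close> sums to zero.\<close>

lemma summation_by_parts:
  fixes h D :: "int \<Rightarrow> real"
  assumes moment: "(\<lambda>z. \<bar>real_of_int z\<bar> * \<bar>h z\<bar>) summable_on UNIV"
    and zero: "(h has_sum 0) UNIV" and D: "\<And>w. \<bar>D w\<bar> \<le> 1"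
  shows "((\<lambda>w. D w * infsum h {w<..}) has_sum (\<Sum>\<^sub>\<infinity>z. signed_sum D z * h z)) UNIV"
proof -
  define F where "F z w = D w * crossing w z * h z" for z w
  have absF: "((\<lambda>w. \<bar>F z w\<bar>) has_sum \<bar>signed_sum (\<lambda>w. \<bar>D w\<bar>) z\<bar> * \<bar>h z\<bar>) UNIV" for z
    using has_sum_cmult_left[OF has_sum_crossing(2), of D z "\<bar>h z\<bar>"] by (simp add: F_def abs_mult)
  have "(\<lambda>x. norm (case x of (z, w) \<Rightarrow> F z w)) summable_on (UNIV \<times> UNIV)"
  proof (rule Infinite_Sum.abs_summable_on_Sigma_iff[THEN iffD2], intro conjI ballI)
    fix z :: int
    show "(\<lambda>w. norm (case (z, w) of (z, w) \<Rightarrow> F z w)) summable_on UNIV"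
      using absF[of z] by (auto simp: summable_on_def)
    have "(\<lambda>z. \<bar>signed_sum (\<lambda>w. \<bar>D w\<bar>) z\<bar> * \<bar>h z\<bar>) summable_on UNIV"
      using moment by (rule summable_on_comparison_test) (auto intro!: mult_right_mono signed_sum_bound D)
    thus "(\<lambda>z. norm (\<Sum>\<^sub>\<infinity>w. norm (case (z, w) of (z, w) \<Rightarrow> F z w))) summable_on UNIV"
      using infsumI[OF absF] by (simp add: abs_mult)
  qed
  hence F: "(\<lambda>(z, w). F z w) summable_on (UNIV \<times> UNIV)"
    using summable_on_iff_abs_summable_on_real by blast
  have h: "h summable_on A" for A
    using zero by (meson summable_on_def summable_on_subset_banach subset_UNIV)
  have column: "(\<Sum>\<^sub>\<infinity>z. F z w) = D w * infsum h {w<..}" for w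
  proof (cases "0 \<le> w")
    case True
    have "(\<Sum>\<^sub>\<infinity>z. F z w) = (\<Sum>\<^sub>\<infinity>z\<in>{w<..}. D w * h z)"
      using True by (intro infsum_cong_neutral) (auto simp: F_def crossing_def)
    thus ?thesis by (simp add: infsum_cmult_right')
  next
    case False
    have "(\<Sum>\<^sub>\<infinity>z. F z w) = (\<Sum>\<^sub>\<infinity>z\<in>{..w}. - D w * h z)"
      using False by (intro infsum_cong_neutral) (auto simp: F_def crossing_def)
    also have "\<dots> = - D w * infsum h {..w}" by (rule infsum_cmult_right')
    finally show ?thesis by (simp add: infsum_tails_opposite[OF zero])
  qed
  have row: "(\<Sum>\<^sub>\<infinity>w. F z w) = signed_sum D z * h z" for z
    using has_sum_cmult_left[OF has_sum_crossing(1), of D z "h z"] by (simp add: F_def infsumI)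
  have F': "(\<lambda>(w, z). F z w) summable_on (UNIV \<times> UNIV)"
    using F by (subst summable_on_swap) simp
  have "(\<lambda>w. \<Sum>\<^sub>\<infinity>z. F z w) summable_on UNIV"
    using summable_on_Sigma_banach[OF F'] by simp
  moreover have "(\<Sum>\<^sub>\<infinity>w. \<Sum>\<^sub>\<infinity>z. F z w) = (\<Sum>\<^sub>\<infinity>z. \<Sum>\<^sub>\<infinity>w. F z w)"
    by (rule infsum_swap_banach[OF F'])
  ultimately show ?thesis
    unfolding has_sum_iff by (simp add: column row)
qed

section \<open>The stationary marginal as a probability mass function\<close>

context deposition_rates
begin

context
  fixes \<theta> :: real
  assumes theta: "theta_lower wmin f < ereal \<theta>" "ereal \<theta> < theta_upper wmax f"
begin

text \<open>Normalising the weights is legitimate because \<^const>\<open>Z_theta\<close> is finite and at least the weight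
  \<open>1\<close> of the state \<open>0\<close>.\<close>

lemma mu_facts:
  shows mu_pos: "z \<in> states \<Longrightarrow> 0 < mu wmin wmax f \<theta> z"
    and mu_has_sum: "(mu wmin wmax f \<theta> has_sum 1) UNIV"
    and mu_moment: "(\<lambda>z. (1 + \<bar>real_of_int z\<bar>)\<^sup>2 * mu wmin wmax f \<theta> z) summable_on UNIV"
proof -
  define W where "W z = exp (\<theta> * real_of_int z) / f_fact f z" for z
  have W_pos: "0 < W z" if "z \<in> states" for z
    using f_fact_pos[OF that] by (simp add: W_def)
  have S2: "(\<lambda>z. (1 + \<bar>real_of_int z\<bar>)\<^sup>2 * W z) summable_on states"
    using weight_summable[OF theta] by (simp add: W_def)
  have S0: "W summable_on states"
    using S2
  proof (rule summable_on_comparison_test)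
    fix z assume z: "z \<in> states"
    have "1 * W z \<le> (1 + \<bar>real_of_int z\<bar>)\<^sup>2 * W z"
      using W_pos[OF z] by (intro mult_right_mono) (auto simp: one_le_power)
    thus "W z \<le> (1 + \<bar>real_of_int z\<bar>)\<^sup>2 * W z" "0 \<le> W z" using W_pos[OF z] by auto
  qed
  define Z where "Z = infsum W states"
  have Z_eq: "Z_theta wmin wmax f \<theta> = Z" by (simp add: Z_theta_def Z_def W_def[abs_def])
  have "sum W {0} \<le> Z"
    unfolding Z_def using S0 zero_in_states W_pos by (intro finite_sum_le_infsum) (auto intro: less_imp_le)
  hence Z: "0 < Z" using W_pos[OF zero_in_states] by simp
  have mu_eq: "mu wmin wmax f \<theta> z = (if z \<in> states then W z / Z else 0)" for z
    by (simp add: mu_def Z_eq W_def)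
  show "z \<in> states \<Longrightarrow> 0 < mu wmin wmax f \<theta> z"
    using W_pos Z by (simp add: mu_eq)
  have "((\<lambda>z. W z / Z) has_sum (Z / Z)) states"
    unfolding Z_def by (intro has_sum_divide_const has_sum_infsum S0)
  thus "(mu wmin wmax f \<theta> has_sum 1) UNIV"
    using Z by (subst has_sum_cong_neutral[of states UNIV "\<lambda>z. W z / Z"]) (auto simp: mu_eq)
  have "(\<lambda>z. ((1 + \<bar>real_of_int z\<bar>)\<^sup>2 * W z) / Z) summable_on states"
    using summable_on_cmult_left[OF S2, of "1 / Z"] by simp
  thus "(\<lambda>z. (1 + \<bar>real_of_int z\<bar>)\<^sup>2 * mu wmin wmax f \<theta> z) summable_on UNIV"
    by (subst summable_on_cong_neutral[of states UNIV "\<lambda>z. ((1 + \<bar>real_of_int z\<bar>)\<^sup>2 * W z) / Z"])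
      (auto simp: mu_eq)
qed

lemma mu_nonneg: "0 \<le> mu wmin wmax f \<theta> z"
  using mu_pos[of z] by (cases "z \<in> states") (auto simp: mu_def)

lemma obtain_stationary_pmf:
  obtains \<nu> where "pmf \<nu> = mu wmin wmax f \<theta>"
proof
  show "pmf (embed_pmf (mu wmin wmax f \<theta>)) = mu wmin wmax f \<theta>"
    using nn_integral_count_space_has_sum[OF mu_nonneg mu_has_sum]
    by (intro ext pmf_embed_pmf) (auto simp: mu_nonneg)
qed

lemma product_mu_eq_PiM_pmf:
  "pmf \<nu> = mu wmin wmax f \<theta> \<Longrightarrow> product_mu wmin wmax f \<theta> = PiM UNIV (\<lambda>_. measure_pmf \<nu>)"
  by (simp add: product_mu_def measure_pmf_eq_density)

text \<open>The centred weight satisfies the hypotheses that \<open>summation_by_parts\<close> puts on \<open>h\<close>; its first moment is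
  controlled by the second moment of \<^const>\<open>mu\<close>.\<close>

lemma centred_weight:
  defines "h \<equiv> \<lambda>z. centred wmin wmax f \<theta> z * mu wmin wmax f \<theta> z"
  shows centred_weight_moment: "(\<lambda>z. \<bar>real_of_int z\<bar> * \<bar>h z\<bar>) summable_on UNIV"
    and centred_weight_sum: "(h has_sum 0) UNIV"
proof -
  define u where "u = mu wmin wmax f \<theta>"
  define m where "m = (\<Sum>\<^sub>\<infinity>y\<in>states. real_of_int y * u y)"
  have h: "h z = (real_of_int z - m) * u z" for z
    by (simp add: h_def centred_def u_def m_def)
  have u0: "0 \<le> u z" for z by (simp add: u_def mu_nonneg)
  have M2: "(\<lambda>z. (1 + \<bar>real_of_int z\<bar>)\<^sup>2 * u z) summable_on UNIV"
    using mu_moment by (simp add: u_def)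
  have "(\<lambda>z. \<bar>real_of_int z * u z\<bar>) summable_on UNIV"
    using M2
  proof (rule summable_on_comparison_test)
    fix z :: int
    have "\<bar>real_of_int z\<bar> * u z \<le> (1 + \<bar>real_of_int z\<bar>)\<^sup>2 * u z"
      using u0 by (intro mult_right_mono) (auto simp: power2_eq_square algebra_simps)
    thus "\<bar>real_of_int z * u z\<bar> \<le> (1 + \<bar>real_of_int z\<bar>)\<^sup>2 * u z"
      using u0[of z] by (simp add: abs_mult)
  qed auto
  hence "(\<lambda>z. real_of_int z * u z) summable_on UNIV"
    using summable_on_iff_abs_summable_on_real[of "\<lambda>z. real_of_int z * u z" UNIV] by simp
  moreover have "m = (\<Sum>\<^sub>\<infinity>z. real_of_int z * u z)"
    unfolding m_def by (rule infsum_cong_neutral) (auto simp: u_def mu_def)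
  ultimately have "((\<lambda>z. real_of_int z * u z) has_sum m) UNIV" by (simp add: has_sum_iff)
  moreover have "((\<lambda>z. - m * u z) has_sum (- m * 1)) UNIV"
    using mu_has_sum by (intro has_sum_cmult_right) (simp add: u_def)
  ultimately have "((\<lambda>z. real_of_int z * u z + - m * u z) has_sum (m + - m * 1)) UNIV"
    by (rule has_sum_add)
  thus "(h has_sum 0) UNIV" by (simp add: h[abs_def] left_diff_distrib)
  show "(\<lambda>z. \<bar>real_of_int z\<bar> * \<bar>h z\<bar>) summable_on UNIV"
  proof (rule summable_on_comparison_test[OF summable_on_cmult_right[OF M2, of "1 + \<bar>m\<bar>"]])
    fix z :: int
    have "\<bar>real_of_int z\<bar> * \<bar>real_of_int z - m\<bar> \<le> \<bar>real_of_int z\<bar> * (\<bar>real_of_int z\<bar> + \<bar>m\<bar>)"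
      by (intro mult_left_mono) auto
    also have "\<dots> \<le> (1 + \<bar>m\<bar>) * (1 + \<bar>real_of_int z\<bar>)\<^sup>2"
    proof -
      have "0 \<le> \<bar>m\<bar> * \<bar>real_of_int z\<bar>" "0 \<le> \<bar>m\<bar> * (\<bar>real_of_int z\<bar> * \<bar>real_of_int z\<bar>)" by auto
      thus ?thesis by (simp add: power2_eq_square algebra_simps)
    qed
    finally have "\<bar>real_of_int z\<bar> * \<bar>real_of_int z - m\<bar> * u z \<le>
        (1 + \<bar>m\<bar>) * (1 + \<bar>real_of_int z\<bar>)\<^sup>2 * u z"
      using u0 by (rule mult_right_mono)
    thus "\<bar>real_of_int z\<bar> * \<bar>h z\<bar> \<le> (1 + \<bar>m\<bar>) * ((1 + \<bar>real_of_int z\<bar>)\<^sup>2 * u z)"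
      using u0[of z] by (simp add: h abs_mult mult.assoc)
  qed auto
qed

lemma centred_weight_tail_nonneg:
  "0 \<le> (\<Sum>\<^sub>\<infinity>z\<in>{w<..}. centred wmin wmax f \<theta> z * mu wmin wmax f \<theta> z)"
  using centred_weight_sum unfolding centred_def by (intro centred_tail_nonneg mu_nonneg)

end
end

section \<open>Adding a particle under a product measure\<close>

lemma sets_PiM_pmf: "sets (PiM UNIV (\<lambda>_. measure_pmf \<nu>)) = sets config_space"
  unfolding config_space_def by (intro sets_PiM_cong) auto

lemma space_config_space: "space config_space = UNIV"
  by (simp add: config_space_def space_PiM)

lemma measurable_coordinate[measurable]: "(\<lambda>\<omega>. \<omega> i) \<in> config_space \<rightarrow>\<^sub>M count_space UNIV"
  unfolding config_space_def by measurable

lemma measurable_add_particle[measurable]: "(\<lambda>\<omega>. add_particle \<omega> i) \<in> config_space \<rightarrow>\<^sub>M config_space"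
  unfolding config_space_def
proof (rule measurable_PiM_single')
  fix j :: int
  show "(\<lambda>\<omega>. add_particle \<omega> i j) \<in> PiM UNIV (\<lambda>_. count_space UNIV) \<rightarrow>\<^sub>M count_space UNIV"
  proof (cases "j = i")
    case True
    have "(\<lambda>\<omega>. \<omega> i) \<in> PiM UNIV (\<lambda>_. count_space UNIV :: int measure) \<rightarrow>\<^sub>M count_space UNIV"
      by simp
    from measurable_compose[OF this, of "\<lambda>z. z + 1" "count_space UNIV"] True
    show ?thesis by (simp add: add_particle_def)
  qed (simp add: add_particle_def)
qed (auto simp: space_PiM)

text \<open>The coordinate \<^term>\<open>i\<close> is independent of the remaining ones, so restricting it to the value
  \<^term>\<open>w\<close> contributes the factor \<^term>\<open>pmf \<nu> w\<close> and leaves a fixed measure on the other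
  coordinates that does not depend on \<^term>\<open>w\<close>.\<close>

lemma product_resample:
  fixes \<nu> :: "int pmf" and k :: "config \<Rightarrow> ennreal"
  assumes k: "k \<in> borel_measurable config_space"
  shows "(\<integral>\<^sup>+\<omega>. k \<omega> * indicator {\<omega>. \<omega> i = w} \<omega> \<partial>PiM UNIV (\<lambda>_. measure_pmf \<nu>)) =
    ennreal (pmf \<nu> w) * (\<integral>\<^sup>+\<omega>. k (fun_upd \<omega> i w) \<partial>PiM (UNIV - {i}) (\<lambda>_. measure_pmf \<nu>))"
proof -
  let ?P = "PiM UNIV (\<lambda>_. measure_pmf \<nu>)" and ?R = "PiM (UNIV - {i}) (\<lambda>_. measure_pmf \<nu>)"
  interpret R: prob_space ?R by (intro prob_space_PiM measure_pmf.prob_space_axioms)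
  have "distr (measure_pmf \<nu> \<Otimes>\<^sub>M ?R) (PiM (insert i (UNIV - {i})) (\<lambda>_. measure_pmf \<nu>)) (\<lambda>(x, X). fun_upd X i x) =
      PiM (insert i (UNIV - {i})) (\<lambda>_. measure_pmf \<nu>)"
    by (rule distr_pair_PiM_eq_PiM) (auto intro: measure_pmf.prob_space_axioms)
  moreover have "insert i (UNIV - {i}) = UNIV" by auto
  ultimately have P: "?P = distr (measure_pmf \<nu> \<Otimes>\<^sub>M ?R) ?P (\<lambda>(x, X). fun_upd X i x)" by simp
  have upd[measurable]: "(\<lambda>(x, X). fun_upd X i x) \<in> measure_pmf \<nu> \<Otimes>\<^sub>M ?R \<rightarrow>\<^sub>M ?P"
    using measurable_add_dim[of i "UNIV - {i}" "\<lambda>_. measure_pmf \<nu>"]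
    by (auto simp: \<open>insert i (UNIV - {i}) = UNIV\<close>)
  have k': "(\<lambda>\<omega>. k \<omega> * indicator {\<omega>. \<omega> i = w} \<omega>) \<in> borel_measurable ?P"
    using k unfolding measurable_cong_sets[OF sets_PiM_pmf refl] by measurable
  have "(\<integral>\<^sup>+\<omega>. k \<omega> * indicator {\<omega>. \<omega> i = w} \<omega> \<partial>?P) =
      (\<integral>\<^sup>+y. (case y of (x, X) \<Rightarrow> k (fun_upd X i x) * indicator {\<omega>. \<omega> i = w} (fun_upd X i x)) \<partial>(measure_pmf \<nu> \<Otimes>\<^sub>M ?R))"
    using k' by (subst P, subst nn_integral_distr[OF upd]) (auto intro!: nn_integral_cong simp: split_beta)
  also have "\<dots> = (\<integral>\<^sup>+x. \<integral>\<^sup>+X. k (fun_upd X i x) * indicator {\<omega>. \<omega> i = w} (fun_upd X i x) \<partial>?R \<partial>measure_pmf \<nu>)"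
    using measurable_compose[OF upd k'] by (subst R.nn_integral_fst[symmetric]) (auto simp: split_beta)
  also have "\<dots> = (\<integral>\<^sup>+x. (\<integral>\<^sup>+X. k (fun_upd X i w) \<partial>?R) * indicator {w} x \<partial>measure_pmf \<nu>)"
    by (intro nn_integral_cong) (auto simp: indicator_def)
  also have "\<dots> = ennreal (pmf \<nu> w) * (\<integral>\<^sup>+X. k (fun_upd X i w) \<partial>?R)"
    by (subst nn_integral_cmult) (auto simp: emeasure_pmf_single mult.commute)
  finally show ?thesis .
qed

text \<open>Adding a particle at \<^term>\<open>i\<close> maps the product measure conditioned on
  \<open>\<omega> i = w\<close> to the product measure conditioned on \<open>\<omega> i = w + 1\<close>. The identity is multiplied
  out, which keeps it meaningful when one of the two events is null.\<close>

lemma product_shift: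
  fixes \<nu> :: "int pmf" and k :: "config \<Rightarrow> ennreal"
  assumes k: "k \<in> borel_measurable config_space"
  shows "ennreal (pmf \<nu> (w + 1)) * (\<integral>\<^sup>+\<omega>. k (add_particle \<omega> i) * indicator {\<omega>. \<omega> i = w} \<omega> \<partial>PiM UNIV (\<lambda>_. measure_pmf \<nu>)) =
    ennreal (pmf \<nu> w) * (\<integral>\<^sup>+\<omega>. k \<omega> * indicator {\<omega>. \<omega> i = w + 1} \<omega> \<partial>PiM UNIV (\<lambda>_. measure_pmf \<nu>))"
proof -
  have "(\<lambda>\<omega>. k (add_particle \<omega> i)) \<in> borel_measurable config_space" using k by measurable
  from product_resample[OF this, where i = i and w = w and \<nu> = \<nu>] product_resample[OF k, where i = i and w = "w + 1" and \<nu> = \<nu>]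
  show ?thesis by (simp add: add_particle_def mult.left_commute)
qed

section \<open>Laws along the coupled process\<close>

text \<open>The hypothesis says that two measures on the integers coincide, namely the images under
  \<^term>\<open>X\<close> and \<^term>\<open>Y\<close> of the rescaled restrictions of \<^term>\<open>M\<close> to
  \<^term>\<open>A\<close> and \<^term>\<open>B\<close>. Equal measures give equal Bochner integrals, also for unbounded
  \<^term>\<open>\<phi>\<close>.\<close>

lemma integral_eq_of_proportional_laws:
  fixes X Y :: "'a \<Rightarrow> int" and \<phi> :: "int \<Rightarrow> real"
  assumes [measurable]: "X \<in> M \<rightarrow>\<^sub>M count_space UNIV" "Y \<in> M \<rightarrow>\<^sub>M count_space UNIV"
      "A \<in> sets M" "B \<in> sets M"
    and nonneg: "0 \<le> a" "0 \<le> b"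
    and laws: "\<And>C. ennreal a * emeasure M {x\<in>space M. x \<in> A \<and> X x \<in> C} =
      ennreal b * emeasure M {x\<in>space M. x \<in> B \<and> Y x \<in> C}"
  shows "a * (\<integral>x. indicator A x * \<phi> (X x) \<partial>M) = b * (\<integral>x. indicator B x * \<phi> (Y x) \<partial>M)"
proof -
  define law where "law c D Z = distr (density M (\<lambda>x. ennreal (c * indicator D x))) (count_space UNIV) Z"
    for c :: real and D :: "'a set" and Z :: "'a \<Rightarrow> int"
  have law_emeasure: "emeasure (law c D Z) C = ennreal c * emeasure M {x\<in>space M. x \<in> D \<and> Z x \<in> C}"
    if [measurable]: "D \<in> sets M" "Z \<in> M \<rightarrow>\<^sub>M count_space UNIV" and "0 \<le> c" for c D Z C
  proof -
    have "emeasure (law c D Z) C = (\<integral>\<^sup>+x. ennreal (c * indicator D x) * indicator (Z -` C \<inter> space M) x \<partial>M)"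
      unfolding law_def by (simp add: emeasure_distr emeasure_density)
    also have "\<dots> = (\<integral>\<^sup>+x. ennreal c * indicator {x\<in>space M. x \<in> D \<and> Z x \<in> C} x \<partial>M)"
      by (intro nn_integral_cong) (auto simp: indicator_def)
    also have "\<dots> = ennreal c * emeasure M {x\<in>space M. x \<in> D \<and> Z x \<in> C}"
      by (intro nn_integral_cmult_indicator) measurable
    finally show ?thesis .
  qed
  have law_integral: "(\<integral>z. \<phi> z \<partial>law c D Z) = c * (\<integral>x. indicator D x * \<phi> (Z x) \<partial>M)"
    if [measurable]: "D \<in> sets M" "Z \<in> M \<rightarrow>\<^sub>M count_space UNIV" and "0 \<le> c" for c D Z
  proof -
    have "(\<integral>z. \<phi> z \<partial>law c D Z) = (\<integral>x. \<phi> (Z x) \<partial>density M (\<lambda>x. ennreal (c * indicator D x)))"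
      unfolding law_def by (rule integral_distr) auto
    also have "\<dots> = (\<integral>x. c * indicator D x * \<phi> (Z x) \<partial>M)"
      using that(3) by (subst integral_density) auto
    finally show ?thesis by (simp add: mult.assoc)
  qed
  have "law a A X = law b B Y"
    by (rule measure_eqI) (auto simp: law_emeasure nonneg laws law_def[THEN arg_cong[where f = sets]])
  thus ?thesis using law_integral[of A X a] law_integral[of B Y b] nonneg by simp
qed

text \<open>The setting of the covariance identity: a stationary process together with the coupled copy that is
  started with one additional particle at the origin.\<close>

locale second_class_particle =
  basic_coupling wmin wmax p q f T K Kc + prob_space M
  for wmin wmax :: "int extended" and p q :: "int \<Rightarrow> int \<Rightarrow> real" and f :: "int \<Rightarrow> real"
    and T :: "config set" and K :: "real \<Rightarrow> config \<Rightarrow> config measure"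
    and Kc :: "real \<Rightarrow> config \<times> config \<Rightarrow> (config \<times> config) measure"
    and M :: "'a measure" +
  fixes \<theta> :: real and \<omega> \<omega>p :: "real \<Rightarrow> 'a \<Rightarrow> config" and Q :: "real \<Rightarrow> 'a \<Rightarrow> int" and E :: "'a set"
  assumes E_def: "E = {x \<in> space M. Fin (\<omega> 0 x 0) < wmax}"
    and theta: "theta_lower wmin f < ereal \<theta>" "ereal \<theta> < theta_upper wmax f"
    and process: "markov_process M config_space T K \<omega>"
    and initial: "distr M config_space (\<omega> 0) = product_mu wmin wmax f \<theta>"
    and coupled_process: "markov_process (restrict_space M E) (config_space \<Otimes>\<^sub>M config_space)
          (ordered_pairs T) Kc (\<lambda>t x. (\<omega> t x, \<omega>p t x))"
    and coupled_initial: "\<And>x. x \<in> E \<Longrightarrow> \<omega>p 0 x = add_particle (\<omega> 0 x) 0"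
    and Q_measurable: "\<And>t. 0 \<le> t \<Longrightarrow> Q t \<in> M \<rightarrow>\<^sub>M count_space UNIV"
    and Q_position: "AE x in M. x \<in> E \<longrightarrow> (\<forall>t\<ge>0. \<omega>p t x = add_particle (\<omega> t x) (Q t x))"
begin

abbreviation "\<mu> \<equiv> mu wmin wmax f \<theta>"
abbreviation "P \<equiv> product_mu wmin wmax f \<theta>"

lemmas \<mu>_pos = mu_pos[OF theta] and \<mu>_nonneg = mu_nonneg[OF theta]

lemma sets_P: "sets P = sets config_space"
  using obtain_stationary_pmf[OF theta] product_mu_eq_PiM_pmf[OF theta] sets_PiM_pmf by metis

lemma measurable_\<omega>: "0 \<le> t \<Longrightarrow> \<omega> t \<in> M \<rightarrow>\<^sub>M config_space"
  using process by (simp add: markov_process_def)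

lemma measurable_height: "0 \<le> t \<Longrightarrow> (\<lambda>x. \<omega> t x n) \<in> M \<rightarrow>\<^sub>M count_space UNIV"
  using measurable_compose[OF measurable_\<omega> measurable_coordinate] .

lemma E_sets[measurable]: "E \<in> sets M"
proof -
  have "E = (\<lambda>x. \<omega> 0 x 0) -` {z. Fin z < wmax} \<inter> space M" by (auto simp: E_def)
  also have "\<dots> \<in> sets M" by (rule measurable_sets[OF measurable_height]) auto
  finally show ?thesis .
qed

text \<open>The kernels are measurable on tempered configurations only. Cutting off outside
  \<^term>\<open>T\<close> gives a function that is measurable on the whole configuration space and agrees with the
  kernel almost everywhere under the laws considered here.\<close>

definition kernel_mass :: "real \<Rightarrow> config set \<Rightarrow> config \<Rightarrow> ennreal" where
  "kernel_mass t B \<eta> = emeasure (K t \<eta>) B * indicator T \<eta>"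

lemma tempered_sets: "T \<in> sets config_space"
  using semigroup by (simp add: markov_semigroup_def)

lemma measurable_kernel_mass:
  assumes "0 \<le> t" and [measurable]: "B \<in> sets config_space"
  shows "kernel_mass t B \<in> borel_measurable config_space"
proof -
  have "K t \<in> restrict_space config_space T \<rightarrow>\<^sub>M prob_algebra config_space"
    using semigroup assms(1) by (simp add: markov_semigroup_def)
  hence "K t \<in> restrict_space config_space T \<rightarrow>\<^sub>M subprob_algebra config_space"
    by (rule measurable_prob_algebraD)
  hence "(\<lambda>\<eta>. emeasure (K t \<eta>) B) \<in> borel_measurable (restrict_space config_space T)"
    by measurable
  thus ?thesis
    unfolding kernel_mass_def[abs_def]
    using tempered_sets by (subst (asm) borel_measurable_restrict_space_iff_ennreal) (auto simp: space_config_space)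
qed

text \<open>The Markov property at time \<open>0\<close> expresses the joint law at times \<open>0\<close> and
  \<^term>\<open>t\<close> through the initial law \<^term>\<open>P\<close> and the kernel alone.\<close>

lemma joint_law:
  assumes t: "0 \<le> t" and B: "B \<in> sets config_space" and C: "C \<in> sets config_space"
  shows "emeasure M {x\<in>space M. \<omega> 0 x \<in> C \<and> \<omega> t x \<in> B} = (\<integral>\<^sup>+\<eta>. kernel_mass t B \<eta> * indicator C \<eta> \<partial>P)"
proof -
  define A where "A = \<omega> 0 -` C \<inter> space M"
  have "A \<in> sigma_sets (space M) {\<omega> u -` C \<inter> space M |u C. 0 \<le> u \<and> u \<le> 0 \<and> C \<in> sets config_space}"
    unfolding A_def using C by (intro sigma_sets.Basic) blast
  hence "emeasure M (A \<inter> \<omega> (0 + t) -` B) = (\<integral>\<^sup>+x\<in>A. emeasure (K t (\<omega> 0 x)) B \<partial>M)"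
    using process t B by (auto simp: markov_process_def)
  moreover have "A \<inter> \<omega> (0 + t) -` B = {x\<in>space M. \<omega> 0 x \<in> C \<and> \<omega> t x \<in> B}"
    by (auto simp: A_def)
  moreover have "(\<integral>\<^sup>+x\<in>A. emeasure (K t (\<omega> 0 x)) B \<partial>M) =
      (\<integral>\<^sup>+x. kernel_mass t B (\<omega> 0 x) * indicator C (\<omega> 0 x) \<partial>M)"
  proof (rule nn_integral_cong_AE)
    have "AE x in M. \<omega> 0 x \<in> T" using process by (simp add: markov_process_def)
    thus "AE x in M. emeasure (K t (\<omega> 0 x)) B * indicator A x = kernel_mass t B (\<omega> 0 x) * indicator C (\<omega> 0 x)"
      using AE_space by eventually_elim (auto simp: kernel_mass_def A_def indicator_def)
  qed
  moreover have "(\<integral>\<^sup>+\<eta>. kernel_mass t B \<eta> * indicator C \<eta> \<partial>P) =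
      (\<integral>\<^sup>+x. kernel_mass t B (\<omega> 0 x) * indicator C (\<omega> 0 x) \<partial>M)"
    unfolding initial[symmetric]
    using measurable_\<omega>[of 0] measurable_kernel_mass[OF t B] C by (subst nn_integral_distr) auto
  ultimately show ?thesis by simp
qed

text \<open>The same for the second component of the coupled pair: its kernel is the marginal of
  \<^term>\<open>Kc\<close>, which is \<^term>\<open>K\<close> started from the configuration with the additional
  particle. That this configuration is tempered for almost every initial configuration with
  \<open>\<omega>\<^sub>0(0) = w\<close> is part of the Markov property of the pair.\<close>

lemma coupled_law:
  assumes t: "0 \<le> t" and B: "B \<in> sets config_space" and w: "Fin w < wmax"
  shows "emeasure M {x\<in>space M. x \<in> E \<and> \<omega> 0 x 0 = w \<and> \<omega>p t x \<in> B} =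
    (\<integral>\<^sup>+\<eta>. kernel_mass t B (add_particle \<eta> 0) * indicator {\<eta>. \<eta> 0 = w} \<eta> \<partial>P)"
proof -
  let ?S = "config_space \<Otimes>\<^sub>M config_space" and ?ME = "restrict_space M E"
  define X where "X t x = (\<omega> t x, \<omega>p t x)" for t x
  define C where "C = {(\<eta>, \<zeta> :: config). \<eta> (0::int) = (w::int)}"
  have spE: "space ?ME = E" using E_sets by simp
  have C: "C \<in> sets ?S"
  proof -
    have "(\<lambda>y. fst y 0) \<in> ?S \<rightarrow>\<^sub>M count_space UNIV"
      by (rule measurable_compose[OF measurable_fst measurable_coordinate])
    from measurable_sets[OF this, of "{w}"] show ?thesis
      by (simp add: C_def space_pair_measure space_config_space vimage_def case_prod_unfold)
  qed
  have B': "snd -` B \<in> sets ?S"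
    using measurable_sets[OF measurable_snd[of config_space config_space] B]
    by (simp add: space_pair_measure space_config_space)
  define A where "A = X 0 -` C \<inter> space ?ME"
  have A: "A = {x\<in>E. \<omega> 0 x 0 = w}" by (auto simp: A_def spE X_def C_def)
  have "A \<in> sigma_sets (space ?ME) {X u -` C \<inter> space ?ME |u C. 0 \<le> u \<and> u \<le> 0 \<and> C \<in> sets ?S}"
    unfolding A_def using C by (intro sigma_sets.Basic) blast
  hence "emeasure ?ME (A \<inter> X (0 + t) -` (snd -` B)) = (\<integral>\<^sup>+x\<in>A. emeasure (Kc t (X 0 x)) (snd -` B) \<partial>?ME)"
    using coupled_process t B' unfolding markov_process_def X_def[symmetric] by force
  moreover have "emeasure ?ME (A \<inter> X (0 + t) -` (snd -` B)) =
      emeasure M {x\<in>space M. x \<in> E \<and> \<omega> 0 x 0 = w \<and> \<omega>p t x \<in> B}"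
    using E_sets sets.sets_into_space[OF E_sets]
    by (subst emeasure_restrict_space) (auto simp: A X_def intro!: arg_cong[where f = "emeasure M"])
  moreover have "(\<integral>\<^sup>+x\<in>A. emeasure (Kc t (X 0 x)) (snd -` B) \<partial>?ME) =
      (\<integral>\<^sup>+x. kernel_mass t B (add_particle (\<omega> 0 x) 0) * indicator {\<eta>. \<eta> 0 = w} (\<omega> 0 x) \<partial>M)"
  proof -
    have kernel: "emeasure (Kc t (\<eta>, \<zeta>)) (snd -` B) = emeasure (K t \<zeta>) B"
      if "(\<eta>, \<zeta>) \<in> ordered_pairs T" for \<eta> \<zeta>
    proof -
      have "Kc t \<in> restrict_space ?S (ordered_pairs T) \<rightarrow>\<^sub>M prob_algebra ?S" "ordered_pairs T \<in> sets ?S"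
        using coupling_semigroup t by (auto simp: markov_semigroup_def)
      hence "Kc t (\<eta>, \<zeta>) \<in> space (prob_algebra ?S)"
        using that by (auto dest!: measurable_space[where x = "(\<eta>, \<zeta>)"])
      hence sets: "sets (Kc t (\<eta>, \<zeta>)) = sets ?S"
        by (simp add: space_prob_algebra)
      hence "snd \<in> Kc t (\<eta>, \<zeta>) \<rightarrow>\<^sub>M config_space"
        by (simp cong: measurable_cong_sets)
      from emeasure_distr[OF this B] coupling_marginals[OF that t] sets_eq_imp_space_eq[OF sets]
      show ?thesis by (simp add: space_pair_measure space_config_space)
    qed
    have "AE x in ?ME. X 0 x \<in> ordered_pairs T"
      using coupled_process by (simp add: markov_process_def X_def)
    hence "AE x in M. x \<in> E \<longrightarrow> X 0 x \<in> ordered_pairs T"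
      using E_sets by (subst (asm) AE_restrict_space_iff) auto
    hence "AE x in M. emeasure (Kc t (X 0 x)) (snd -` B) * indicator A x * indicator E x =
        kernel_mass t B (add_particle (\<omega> 0 x) 0) * indicator {\<eta>. \<eta> 0 = w} (\<omega> 0 x)"
      using AE_space
    proof eventually_elim
      case (elim x)
      show ?case
      proof (cases "\<omega> 0 x 0 = w")
        case True
        hence "x \<in> E" using w elim by (simp add: E_def)
        with elim have "(\<omega> 0 x, add_particle (\<omega> 0 x) 0) \<in> ordered_pairs T"
          by (simp add: X_def coupled_initial)
        moreover from this have "add_particle (\<omega> 0 x) 0 \<in> T" by (simp add: ordered_pairs_def)
        ultimately show ?thesis
          using True \<open>x \<in> E\<close> by (simp add: kernel A X_def coupled_initial kernel_mass_def)
      qed (simp add: A)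
    qed
    thus ?thesis
      using E_sets by (subst nn_integral_restrict_space) (auto intro: nn_integral_cong_AE)
  qed
  moreover have "(\<integral>\<^sup>+\<eta>. kernel_mass t B (add_particle \<eta> 0) * indicator {\<eta>. \<eta> 0 = w} \<eta> \<partial>P) =
      (\<integral>\<^sup>+x. kernel_mass t B (add_particle (\<omega> 0 x) 0) * indicator {\<eta>. \<eta> 0 = w} (\<omega> 0 x) \<partial>M)"
  proof -
    have "(\<lambda>\<eta>. kernel_mass t B (add_particle \<eta> 0) * indicator {\<eta>. \<eta> 0 = w} \<eta>) \<in> borel_measurable config_space"
      using measurable_kernel_mass[OF t B] by measurable
    thus ?thesis
      unfolding initial[symmetric] using measurable_\<omega>[of 0] by (subst nn_integral_distr) auto
  qed
  ultimately show ?thesis by simp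
qed

text \<open>Given \<open>\<omega>\<^sub>0(0) = w\<close>, the configuration with the second class particle evolves like the
  process given \<open>\<omega>\<^sub>0(0) = w + 1\<close>: both use the same kernel, and \<open>product_shift\<close> identifies
  the two initial laws.\<close>

lemma levels_proportional:
  assumes t: "0 \<le> t" and B: "B \<in> sets config_space" and w: "Fin w < wmax"
  shows "ennreal (\<mu> (w + 1)) * emeasure M {x\<in>space M. x \<in> E \<and> \<omega> 0 x 0 = w \<and> \<omega>p t x \<in> B} =
    ennreal (\<mu> w) * emeasure M {x\<in>space M. \<omega> 0 x 0 = w + 1 \<and> \<omega> t x \<in> B}"
proof -
  obtain \<nu> where \<nu>: "pmf \<nu> = \<mu>" using obtain_stationary_pmf[OF theta] .
  have "{\<eta>. \<eta> 0 = w + 1} \<in> sets config_space"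
    using measurable_sets[OF measurable_coordinate[of 0], of "{w + 1}"]
    by (simp add: space_config_space vimage_def)
  from joint_law[OF t B this] coupled_law[OF t B w]
    product_shift[OF measurable_kernel_mass[OF t B], where \<nu> = \<nu> and w = w and i = 0]
  show ?thesis by (simp add: \<nu> product_mu_eq_PiM_pmf[OF theta \<nu>])
qed

lemma law_stationary:
  assumes t: "0 \<le> t"
  shows "distr M config_space (\<omega> t) = P"
proof (rule measure_eqI)
  fix B assume "B \<in> sets (distr M config_space (\<omega> t))"
  hence B: "B \<in> sets config_space" by simp
  have "emeasure (distr M config_space (\<omega> t)) B = emeasure M {x\<in>space M. \<omega> 0 x \<in> UNIV \<and> \<omega> t x \<in> B}"
    using measurable_\<omega>[OF t] B by (auto simp: emeasure_distr intro!: arg_cong[where f = "emeasure M"])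
  also have "\<dots> = (\<integral>\<^sup>+\<eta>. kernel_mass t B \<eta> * indicator UNIV \<eta> \<partial>P)"
    using sets.top[of config_space] by (intro joint_law t B) (simp add: space_config_space)
  also have "\<dots> = (\<integral>\<^sup>+\<eta>. emeasure (K t \<eta>) B \<partial>P)"
    using tempered_full[OF theta] by (intro nn_integral_cong_AE) (auto elim!: eventually_mono simp: kernel_mass_def)
  also have "\<dots> = emeasure P B" by (rule stationary[OF theta t B])
  finally show "emeasure (distr M config_space (\<omega> t)) B = emeasure P B" .
qed (simp add: sets_P)

lemma marginal_law:
  assumes t: "0 \<le> t" and \<nu>: "pmf \<nu> = \<mu>"
  shows "distr M (measure_pmf \<nu>) (\<lambda>x. \<omega> t x n) = measure_pmf \<nu>"
proof -
  have comp: "(\<lambda>\<eta>. \<eta> n) \<in> config_space \<rightarrow>\<^sub>M measure_pmf \<nu>"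
    using measurable_coordinate by (simp cong: measurable_cong_sets)
  have "distr M (measure_pmf \<nu>) (\<lambda>x. \<omega> t x n) = distr P (measure_pmf \<nu>) (\<lambda>\<eta>. \<eta> n)"
    unfolding law_stationary[OF t, symmetric]
    using distr_distr[OF comp measurable_\<omega>[OF t]] by (simp add: o_def)
  also have "\<dots> = measure_pmf \<nu>"
    unfolding product_mu_eq_PiM_pmf[OF theta \<nu>]
    by (rule distr_PiM_component) (auto intro: measure_pmf.prob_space_axioms)
  finally show ?thesis .
qed

lemma marginal_integral:
  fixes \<phi> :: "int \<Rightarrow> real"
  assumes t: "0 \<le> t" and \<phi>: "(\<lambda>z. \<mu> z * \<phi> z) summable_on UNIV"
  shows "integrable M (\<lambda>x. \<phi> (\<omega> t x n))" "(\<integral>x. \<phi> (\<omega> t x n) \<partial>M) = (\<Sum>\<^sub>\<infinity>z. \<mu> z * \<phi> z)"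
proof -
  obtain \<nu> where \<nu>: "pmf \<nu> = \<mu>" using obtain_stationary_pmf[OF theta] .
  have m: "(\<lambda>x. \<omega> t x n) \<in> M \<rightarrow>\<^sub>M measure_pmf \<nu>"
    using measurable_height[OF t] by (simp cong: measurable_cong_sets)
  have "(\<lambda>z. pmf \<nu> z * \<phi> z) summable_on UNIV" using \<phi> by (simp add: \<nu>)
  from integrable_pmf_summable[OF this]
  have *: "integrable (distr M (measure_pmf \<nu>) (\<lambda>x. \<omega> t x n)) \<phi>"
      "(\<integral>z. \<phi> z \<partial>distr M (measure_pmf \<nu>) (\<lambda>x. \<omega> t x n)) = (\<Sum>\<^sub>\<infinity>z. \<mu> z * \<phi> z)"
    by (simp_all add: marginal_law[OF t \<nu>] \<nu>)
  show "integrable M (\<lambda>x. \<phi> (\<omega> t x n))"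
    using *(1) m by (subst (asm) integrable_distr_eq) auto
  show "(\<integral>x. \<phi> (\<omega> t x n) \<partial>M) = (\<Sum>\<^sub>\<infinity>z. \<mu> z * \<phi> z)"
    using *(2) m by (subst (asm) integral_distr) auto
qed

end

context second_class_particle
begin

section \<open>The covariance identity\<close>

abbreviation "g \<equiv> centred wmin wmax f \<theta>"

definition "tail_ratio w = (\<Sum>\<^sub>\<infinity>z\<in>{z \<in> states. w < z}. g z * (\<mu> z / \<mu> w))"

lemmas summable_square_weight = mu_moment[OF theta]
  and weight_moment = centred_weight_moment[OF theta]
  and weight_sum = centred_weight_sum[OF theta]

lemma mu_outside: "z \<notin> states \<Longrightarrow> \<mu> z = 0"
  by (simp add: mu_def)

lemma tail_ratio_eq: "tail_ratio w = (\<Sum>\<^sub>\<infinity>z\<in>{w<..}. g z * \<mu> z) / \<mu> w"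
proof -
  have "tail_ratio w = (\<Sum>\<^sub>\<infinity>z\<in>{w<..}. g z * \<mu> z * (1 / \<mu> w))"
    unfolding tail_ratio_def by (rule infsum_cong_neutral) (auto simp: mu_outside)
  also have "\<dots> = (\<Sum>\<^sub>\<infinity>z\<in>{w<..}. g z * \<mu> z) * (1 / \<mu> w)"
    by (rule infsum_cmult_left')
  finally show ?thesis by simp
qed

lemma tail_ratio_nonneg: "0 \<le> tail_ratio w"
  using centred_weight_tail_nonneg[OF theta] \<mu>_nonneg by (simp add: tail_ratio_eq)

lemma tail_ratio_summable: "(\<lambda>z. g z * (\<mu> z / \<mu> w)) summable_on {z \<in> states. w < z}"
proof -
  have "(\<lambda>z. g z * \<mu> z) summable_on UNIV"
    using weight_sum by (auto simp: summable_on_def)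
  hence "(\<lambda>z. g z * \<mu> z) summable_on {z \<in> states. w < z}"
    by (rule summable_on_subset_banach) auto
  from summable_on_cmult_left[OF this, of "1 / \<mu> w"] show ?thesis by simp
qed

lemma tail_ratio_top:
  assumes "w \<in> states" "w + 1 \<notin> states"
  shows "tail_ratio w = 0"
proof -
  have False if "z \<in> states" "w < z" for z
    using local_states_convex[OF assms(1) that(1), of "w + 1"] assms(2) that(2) by simp
  hence "{z \<in> states. w < z} = {}" by auto
  thus ?thesis by (simp only: tail_ratio_def infsum_empty)
qed

lemma states_below_top: "w + 1 \<in> states \<Longrightarrow> Fin w < wmax"
  by (cases wmax) (auto simp: local_states_def)

lemma square_integrable_height:
  assumes t: "0 \<le> t"
  shows "integrable M (\<lambda>x. (real_of_int (\<omega> t x n))\<^sup>2)"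
proof (rule marginal_integral(1)[OF t])
  show "(\<lambda>z. \<mu> z * (real_of_int z)\<^sup>2) summable_on UNIV"
    using summable_square_weight
  proof (rule summable_on_comparison_test)
    fix z :: int
    have "(real_of_int z)\<^sup>2 * \<mu> z \<le> (1 + \<bar>real_of_int z\<bar>)\<^sup>2 * \<mu> z"
      using \<mu>_nonneg by (intro mult_right_mono) (auto simp: power2_eq_square algebra_simps)
    thus "\<mu> z * (real_of_int z)\<^sup>2 \<le> (1 + \<bar>real_of_int z\<bar>)\<^sup>2 * \<mu> z"
      by (simp add: mult.commute)
  qed (simp add: \<mu>_nonneg)
qed

lemma integrable_height:
  assumes t: "0 \<le> t"
  shows "integrable M (\<lambda>x. real_of_int (\<omega> t x n))"
proof (rule square_integrable_imp_integrable[OF _ square_integrable_height[OF t]])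
  show "(\<lambda>x. real_of_int (\<omega> t x n)) \<in> borel_measurable M"
    by (rule measurable_compose[OF measurable_height[OF t]]) simp
qed

lemma integrable_height_product:
  assumes t: "0 \<le> t"
  shows "integrable M (\<lambda>x. real_of_int (\<omega> t x n) * real_of_int (\<omega> 0 x 0))"
proof (rule Bochner_Integration.integrable_bound)
  show "integrable M (\<lambda>x. (real_of_int (\<omega> t x n))\<^sup>2 + (real_of_int (\<omega> 0 x 0))\<^sup>2)"
    using square_integrable_height[OF t] square_integrable_height[of 0] by (intro Bochner_Integration.integrable_add) auto
  show "AE x in M. norm (real_of_int (\<omega> t x n) * real_of_int (\<omega> 0 x 0)) \<le>
      norm ((real_of_int (\<omega> t x n))\<^sup>2 + (real_of_int (\<omega> 0 x 0))\<^sup>2)"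
  proof (rule AE_I2)
    fix x
    have "\<bar>a\<bar> * \<bar>b\<bar> \<le> a\<^sup>2 + b\<^sup>2" for a b :: real
    proof -
      have "0 \<le> \<bar>a\<bar> * \<bar>b\<bar>" by simp
      thus ?thesis using sum_squares_bound[of "\<bar>a\<bar>" "\<bar>b\<bar>"] unfolding power2_abs by linarith
    qed
    thus "norm (real_of_int (\<omega> t x n) * real_of_int (\<omega> 0 x 0)) \<le>
      norm ((real_of_int (\<omega> t x n))\<^sup>2 + (real_of_int (\<omega> 0 x 0))\<^sup>2)"
      by (simp add: abs_mult)
  qed
  show "(\<lambda>x. real_of_int (\<omega> t x n) * real_of_int (\<omega> 0 x 0)) \<in> borel_measurable M"
  proof -
    have [measurable]: "(\<lambda>x. \<omega> t x n) \<in> M \<rightarrow>\<^sub>M count_space UNIV"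
        "(\<lambda>x. \<omega> 0 x 0) \<in> M \<rightarrow>\<^sub>M count_space UNIV"
      using t by (auto intro: measurable_height)
    show ?thesis by measurable
  qed
qed

definition level :: "int \<Rightarrow> 'a set" where
  "level w = {x \<in> space M. \<omega> 0 x 0 = w}"

lemma level_sets[measurable]: "level w \<in> sets M"
proof -
  have "level w = (\<lambda>x. \<omega> 0 x 0) -` {w} \<inter> space M" by (auto simp: level_def)
  also have "\<dots> \<in> sets M" by (rule measurable_sets[OF measurable_height]) auto
  finally show ?thesis .
qed

lemma measure_level: "measure M (level w) = \<mu> w"
proof -
  have "((\<lambda>z. \<mu> z * indicator {w} z) has_sum \<mu> w) UNIV"
    by (rule has_sum_finite_neutralI[of "{w}"]) auto
  with marginal_integral(2)[of 0 "indicator {w}" 0]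
  have "(\<integral>x. indicator {w} (\<omega> 0 x 0) \<partial>M) = \<mu> w" by (simp add: has_sum_iff)
  also have "(\<integral>x. indicator {w} (\<omega> 0 x 0) \<partial>M) = (\<integral>x. indicator (level w) x \<partial>M)"
    by (intro Bochner_Integration.integral_cong) (auto simp: level_def indicator_def)
  finally show ?thesis by simp
qed

definition particle_at :: "real \<Rightarrow> int \<Rightarrow> 'a set" where
  "particle_at t n = {x \<in> E. Q t x = n}"

lemma particle_at_sets: "0 \<le> t \<Longrightarrow> particle_at t n \<in> sets M"
proof -
  assume "0 \<le> t"
  have "particle_at t n = (Q t -` {n} \<inter> space M) \<inter> E"
    using sets.sets_into_space[OF E_sets] by (auto simp: particle_at_def)
  thus ?thesis using measurable_sets[OF Q_measurable[OF \<open>0 \<le> t\<close>], of "{n}"] by simp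
qed

text \<open>Expectations restricted to an event \<open>\<omega>\<^sub>0(0) = w\<close>, without division by its probability; the
  same holds for \<open>level_mass\<close> below.\<close>

definition level_mean :: "real \<Rightarrow> int \<Rightarrow> int \<Rightarrow> real" where
  "level_mean t n w = (\<integral>x. indicator (level w) x * real_of_int (\<omega> t x n) \<partial>M)"

definition level_mass :: "real \<Rightarrow> int \<Rightarrow> int \<Rightarrow> real" where
  "level_mass t n w = measure M (level w \<inter> particle_at t n)"

text \<open>The increment of the conditional mean of \<open>\<omega>\<^sub>n(t)\<close> when \<open>\<omega>\<^sub>0(0)\<close> grows from
  \<^term>\<open>w\<close> to \<^term>\<open>w + 1\<close> is the conditional probability of \<open>Q(t) = n\<close>, since the second
  component of the pair exceeds the first at \<^term>\<open>n\<close> by the indicator of that event. The identity is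
  again multiplied out.\<close>

lemma level_increment:
  assumes t: "0 \<le> t" and w: "Fin w < wmax"
  shows "\<mu> (w + 1) * (level_mean t n w + level_mass t n w) = \<mu> w * level_mean t n (w + 1)"
proof -
  note [measurable] = measurable_height[OF t, of n] particle_at_sets[OF t, of n]
  \<comment> \<open>The value at \<open>n\<close> of the second component on \<open>E\<close>, almost everywhere. That component is measurable on \<open>E\<close> only, whereas \<open>Y\<close> is measurable everywhere.\<close>
  define Y where "Y x = \<omega> t x n + (if x \<in> particle_at t n then 1 else 0)" for x
  have Y[measurable]: "Y \<in> M \<rightarrow>\<^sub>M count_space UNIV"
  proof -
    have "(\<lambda>x. if x \<in> particle_at t n then \<omega> t x n + 1 else \<omega> t x n) \<in> M \<rightarrow>\<^sub>M count_space UNIV"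
      using measurable_compose[OF measurable_height[OF t], of "\<lambda>z. z + 1" "count_space UNIV" n]
      by (intro measurable_If_set measurable_height t) auto
    moreover have "(\<lambda>x. if x \<in> particle_at t n then \<omega> t x n + 1 else \<omega> t x n) = Y"
      by (auto simp: Y_def)
    ultimately show ?thesis by simp
  qed
  have "\<mu> (w + 1) * (\<integral>x. indicator (level w) x * real_of_int (Y x) \<partial>M) =
      \<mu> w * (\<integral>x. indicator (level (w + 1)) x * real_of_int (\<omega> t x n) \<partial>M)"
  proof (rule integral_eq_of_proportional_laws)
    fix C :: "int set"
    define B where "B = {\<eta> :: config. \<eta> n \<in> C}"
    have B: "B \<in> sets config_space"
      using measurable_sets[OF measurable_coordinate[of n], of C]
      by (simp add: B_def space_config_space vimage_def)
    have "(\<lambda>x. (\<omega> t x, \<omega>p t x)) \<in> restrict_space M E \<rightarrow>\<^sub>M config_space \<Otimes>\<^sub>M config_space"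
      using coupled_process t by (simp add: markov_process_def)
    from measurable_sets[OF measurable_compose[OF this measurable_snd] B]
    have "(\<lambda>x. \<omega>p t x) -` B \<inter> space (restrict_space M E) \<in> sets (restrict_space M E)"
      by simp
    moreover have "(\<lambda>x. \<omega>p t x) -` B \<inter> space (restrict_space M E) = {x \<in> E. \<omega>p t x \<in> B}"
      using E_sets by auto
    ultimately have "{x \<in> E. \<omega>p t x \<in> B} \<in> sets (restrict_space M E)" by simp
    hence "{x \<in> E. \<omega>p t x \<in> B} \<in> sets M"
      using E_sets by (subst (asm) sets_restrict_space_iff) auto
    hence "level w \<inter> {x \<in> E. \<omega>p t x \<in> B} \<in> sets M" by (intro sets.Int level_sets)
    moreover have "level w \<inter> {x \<in> E. \<omega>p t x \<in> B} =
        {x \<in> space M. x \<in> E \<and> \<omega> 0 x 0 = w \<and> \<omega>p t x \<in> B}"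
      by (auto simp: level_def)
    ultimately have meas: "{x \<in> space M. x \<in> E \<and> \<omega> 0 x 0 = w \<and> \<omega>p t x \<in> B} \<in> sets M" by simp
    have "emeasure M {x \<in> space M. x \<in> level w \<and> Y x \<in> C} =
        emeasure M {x \<in> space M. x \<in> E \<and> \<omega> 0 x 0 = w \<and> \<omega>p t x \<in> B}"
    proof (rule emeasure_eq_AE[OF _ _ meas])
      show "AE x in M. x \<in> {x \<in> space M. x \<in> level w \<and> Y x \<in> C} \<longleftrightarrow>
          x \<in> {x \<in> space M. x \<in> E \<and> \<omega> 0 x 0 = w \<and> \<omega>p t x \<in> B}"
        using Q_position
      proof eventually_elim
        case (elim x)
        have "x \<in> E" if "x \<in> level w" using that w by (simp add: level_def E_def)
        moreover have "\<omega>p t x n = Y x" if "x \<in> E"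
          using elim that t by (simp add: Y_def particle_at_def add_particle_def)
        ultimately show ?case by (auto simp: level_def B_def)
      qed
    qed measurable
    moreover have "{x \<in> space M. x \<in> level (w + 1) \<and> \<omega> t x n \<in> C} =
        {x \<in> space M. \<omega> 0 x 0 = w + 1 \<and> \<omega> t x \<in> B}"
      by (auto simp: level_def B_def)
    ultimately show "ennreal (\<mu> (w + 1)) * emeasure M {x \<in> space M. x \<in> level w \<and> Y x \<in> C} =
        ennreal (\<mu> w) * emeasure M {x \<in> space M. x \<in> level (w + 1) \<and> \<omega> t x n \<in> C}"
      using levels_proportional[OF t B w] by simp
  qed (use \<mu>_nonneg in measurable)
  moreover have "(\<integral>x. indicator (level w) x * real_of_int (Y x) \<partial>M) = level_mean t n w + level_mass t n w"
  proof -
    have i1: "integrable M (\<lambda>x. indicator (level w) x * real_of_int (\<omega> t x n))"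
      using integrable_real_mult_indicator[OF level_sets integrable_height[OF t, of n]] by (simp add: mult.commute)
    have i2: "integrable M (indicator (level w \<inter> particle_at t n) :: 'a \<Rightarrow> real)"
      by (intro integrable_real_indicator) (auto simp: less_top[symmetric])
    have "(\<integral>x. indicator (level w) x * real_of_int (Y x) \<partial>M) =
        (\<integral>x. indicator (level w) x * real_of_int (\<omega> t x n) + indicator (level w \<inter> particle_at t n) x \<partial>M)"
      by (intro Bochner_Integration.integral_cong) (auto simp: Y_def indicator_def)
    also have "\<dots> = level_mean t n w + level_mass t n w"
      using Bochner_Integration.integral_add[OF i1 i2] by (simp add: level_mean_def level_mass_def)
    finally show ?thesis .
  qed
  ultimately show ?thesis by (simp add: level_mean_def)
qed

lemma level_mass_bounds: "0 \<le> t \<Longrightarrow> 0 \<le> level_mass t n w" "0 \<le> t \<Longrightarrow> level_mass t n w \<le> \<mu> w"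
  unfolding level_mass_def using finite_measure_mono[of "level w \<inter> particle_at t n" "level w"]
  by (auto simp: measure_level)

lemma level_mean_outside:
  assumes w: "w \<notin> states"
  shows "level_mean t n w = 0"
proof -
  have "AE x in M. \<omega> 0 x \<in> T" using process by (simp add: markov_process_def)
  hence "AE x in M. indicator (level w) x * real_of_int (\<omega> t x n) = 0"
    using tempered_subset w by (auto elim!: eventually_mono simp: level_def indicator_def)
  thus ?thesis unfolding level_mean_def by (rule integral_eq_zero_AE)
qed

text \<open>Centring one of the two factors suffices: the constant subtracted from the other is multiplied by an
  integral of \<^term>\<open>g\<close> that vanishes.\<close>

lemma covariance_by_levels:
  assumes t: "0 \<le> t"
  shows "((\<lambda>z. g z * level_mean t n z) has_sum
    covariance M (\<lambda>x. real_of_int (\<omega> t x n)) (\<lambda>x. real_of_int (\<omega> 0 x 0))) UNIV"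
proof -
  define m where "m = (\<Sum>\<^sub>\<infinity>y\<in>states. real_of_int y * \<mu> y)"
  define v where "v = (\<integral>x. real_of_int (\<omega> t x n) \<partial>M)"
  have g: "g z = real_of_int z - m" for z by (simp add: centred_def m_def)
  have "((\<lambda>z. \<mu> z * g z) has_sum 0) UNIV" using weight_sum by (simp add: mult.commute)
  from marginal_integral[OF _ has_sum_imp_summable[OF this], of 0 0] infsumI[OF this]
  have g0: "integrable M (\<lambda>x. g (\<omega> 0 x 0))" "(\<integral>x. g (\<omega> 0 x 0) \<partial>M) = 0" by simp_all
  have mean: "(\<integral>x. real_of_int (\<omega> 0 x 0) \<partial>M) = m"
    using g0(2) integrable_height[of 0 0] by (simp add: g prob_space)
  have vg: "integrable M (\<lambda>x. real_of_int (\<omega> t x n) * g (\<omega> 0 x 0))"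
    using integrable_height_product[OF t, of n] integrable_height[OF t, of n]
    by (simp add: g right_diff_distrib)
  have "covariance M (\<lambda>x. real_of_int (\<omega> t x n)) (\<lambda>x. real_of_int (\<omega> 0 x 0)) =
      (\<integral>x. real_of_int (\<omega> t x n) * g (\<omega> 0 x 0) - v * g (\<omega> 0 x 0) \<partial>M)"
    unfolding covariance_def mean v_def[symmetric] by (simp add: g left_diff_distrib)
  also have "\<dots> = (\<integral>x. real_of_int (\<omega> t x n) * g (\<omega> 0 x 0) \<partial>M)"
    using vg g0 by (subst Bochner_Integration.integral_diff) auto
  finally have cov: "covariance M (\<lambda>x. real_of_int (\<omega> t x n)) (\<lambda>x. real_of_int (\<omega> 0 x 0)) =
      (\<integral>x. real_of_int (\<omega> t x n) * g (\<omega> 0 x 0) \<partial>M)" .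
  have "(\<integral>x. indicator {x. \<omega> 0 x 0 = z} x * (real_of_int (\<omega> t x n) * g (\<omega> 0 x 0)) \<partial>M) =
      g z * level_mean t n z" for z
  proof -
    have "(\<integral>x. indicator {x. \<omega> 0 x 0 = z} x * (real_of_int (\<omega> t x n) * g (\<omega> 0 x 0)) \<partial>M) =
        (\<integral>x. g z * (indicator (level z) x * real_of_int (\<omega> t x n)) \<partial>M)"
      by (intro Bochner_Integration.integral_cong) (auto simp: level_def indicator_def)
    thus ?thesis by (simp add: level_mean_def)
  qed
  with has_sum_integral_over_levels[OF measurable_height[of 0 0] vg] show ?thesis by (simp add: cov)
qed

text \<open>Integrability amounts to summability over \<open>w\<close> of the upper tails of \<open>g * \<mu>\<close>. This is
  the convergence part of \<open>summation_by_parts\<close> applied to the indicator of the state space, for which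
  the sum equals the variance of \<^const>\<open>mu\<close>.\<close>

lemma particle_integral_by_levels:
  assumes t: "0 \<le> t"
  shows "integrable M (\<lambda>x. indicator (particle_at t n) x * tail_ratio (\<omega> 0 x 0))"
    and "((\<lambda>w. tail_ratio w * level_mass t n w) has_sum
      (\<integral>x. indicator (particle_at t n) x * tail_ratio (\<omega> 0 x 0) \<partial>M)) UNIV"
proof -
  note [measurable] = particle_at_sets[OF t, of n]
  have "((\<lambda>w. indicator states w * (\<Sum>\<^sub>\<infinity>z\<in>{w<..}. g z * \<mu> z)) has_sum
      (\<Sum>\<^sub>\<infinity>z. signed_sum (indicator states) z * (g z * \<mu> z))) UNIV"
    by (rule summation_by_parts[OF weight_moment weight_sum]) (auto simp: indicator_def)
  moreover have "indicator states w * (\<Sum>\<^sub>\<infinity>z\<in>{w<..}. g z * \<mu> z) = \<mu> w * tail_ratio w" for w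
    using \<mu>_pos[of w] mu_outside[of w] by (cases "w \<in> states") (auto simp: tail_ratio_eq)
  ultimately have "(\<lambda>w. \<mu> w * tail_ratio w) summable_on UNIV"
    by (auto simp: summable_on_def)
  hence ratio: "integrable M (\<lambda>x. tail_ratio (\<omega> 0 x 0))"
    by (rule marginal_integral(1)[of 0, simplified])
  show *: "integrable M (\<lambda>x. indicator (particle_at t n) x * tail_ratio (\<omega> 0 x 0))"
    using integrable_real_mult_indicator[OF particle_at_sets[OF t, of n] ratio] by (simp add: mult.commute)
  have "(\<integral>x. indicator {x. \<omega> 0 x 0 = w} x * (indicator (particle_at t n) x * tail_ratio (\<omega> 0 x 0)) \<partial>M) =
      tail_ratio w * level_mass t n w" for w
  proof -
    have "(\<integral>x. indicator {x. \<omega> 0 x 0 = w} x * (indicator (particle_at t n) x * tail_ratio (\<omega> 0 x 0)) \<partial>M) =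
        (\<integral>x. tail_ratio w * indicator (level w \<inter> particle_at t n) x \<partial>M)"
      by (intro Bochner_Integration.integral_cong) (auto simp: level_def indicator_def)
    thus ?thesis by (simp add: level_mass_def)
  qed
  with has_sum_integral_over_levels[OF measurable_height[of 0 0] *]
  show "((\<lambda>w. tail_ratio w * level_mass t n w) has_sum
      (\<integral>x. indicator (particle_at t n) x * tail_ratio (\<omega> 0 x 0) \<partial>M)) UNIV" by simp
qed

text \<open>Summation by parts with \<open>A\<close> the conditional mean of \<open>\<omega>\<^sub>n(t)\<close> and \<open>D\<close> the
  conditional probability of \<open>Q(t) = n\<close>. At a finite top state \<open>D\<close> is set to zero, in accordance
  with the empty tail there.\<close>

lemma covariance_eq_particle_integral:
  assumes t: "0 \<le> t"
  shows "covariance M (\<lambda>x. real_of_int (\<omega> t x n)) (\<lambda>x. real_of_int (\<omega> 0 x 0)) =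
    (\<integral>x. indicator (particle_at t n) x * tail_ratio (\<omega> 0 x 0) \<partial>M)"
proof -
  define A where "A z = level_mean t n z / \<mu> z" for z
  define D where "D w = (if w \<in> states \<and> w + 1 \<in> states then level_mass t n w / \<mu> w else 0)" for w
  have incr: "A (w + 1) - A w = D w" if "w \<in> states" "w + 1 \<in> states" for w
  proof -
    have "level_mean t n (w + 1) / \<mu> (w + 1) = (level_mean t n w + level_mass t n w) / \<mu> w"
      using level_increment[OF t states_below_top[OF that(2)], of n] \<mu>_pos[OF that(1)] \<mu>_pos[OF that(2)]
      by (simp add: frac_eq_eq mult.commute)
    thus ?thesis using that by (simp add: A_def D_def add_divide_distrib)
  qed
  have D: "\<bar>D w\<bar> \<le> 1" for w
    using level_mass_bounds[OF t, of n w] \<mu>_pos[of w] by (auto simp: D_def)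
  \<comment> \<open>The base value \<open>A 0\<close> drops out below, because the centred weights sum to zero.\<close>
  have row: "signed_sum D z * (g z * \<mu> z) = g z * level_mean t n z + (- A 0) * (g z * \<mu> z)" for z
  proof (cases "z \<in> states")
    case True
    have "signed_sum D z = A z - A 0"
      by (rule signed_sum_increments[where A = A and D = D, OF _ zero_in_states True incr]) (auto intro: local_states_convex)
    moreover have "A z * \<mu> z = level_mean t n z" using \<mu>_pos[OF True] by (simp add: A_def)
    ultimately show ?thesis by (simp add: left_diff_distrib mult.left_commute)
  qed (simp add: mu_outside level_mean_outside)
  have "((\<lambda>z. signed_sum D z * (g z * \<mu> z)) has_sum
      (covariance M (\<lambda>x. real_of_int (\<omega> t x n)) (\<lambda>x. real_of_int (\<omega> 0 x 0)) + (- A 0) * 0)) UNIV"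
    unfolding row by (intro has_sum_add covariance_by_levels t has_sum_cmult_right weight_sum)
  moreover have "D w * (\<Sum>\<^sub>\<infinity>z\<in>{w<..}. g z * \<mu> z) = tail_ratio w * level_mass t n w" for w
  proof (cases "w \<in> states")
    case True
    thus ?thesis using tail_ratio_top[OF True] by (auto simp: D_def tail_ratio_eq)
  next
    case False
    thus ?thesis using level_mass_bounds[OF t, of n w] by (simp add: D_def mu_outside)
  qed
  hence "((\<lambda>w. tail_ratio w * level_mass t n w) has_sum (\<Sum>\<^sub>\<infinity>z. signed_sum D z * (g z * \<mu> z))) UNIV"
    using summation_by_parts[where D = D, OF weight_moment weight_sum D] by simp
  ultimately show ?thesis
    using has_sum_unique[OF particle_integral_by_levels(2)[OF t]] by (simp add: infsumI)
qed

end

theorem theorem2p2: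
  fixes wmin wmax :: "int extended"
    and p q :: "int \<Rightarrow> int \<Rightarrow> real"
    and f :: "int \<Rightarrow> real"
    and T :: "config set"
    and K :: "real \<Rightarrow> config \<Rightarrow> config measure"
    and Kc :: "real \<Rightarrow> config \<times> config \<Rightarrow> (config \<times> config) measure"
    and \<theta> :: real
    and M :: "'a measure"
    and \<omega> \<omega>p :: "real \<Rightarrow> 'a \<Rightarrow> config"
    and Q :: "real \<Rightarrow> 'a \<Rightarrow> int"
  defines "I \<equiv> local_states wmin wmax"
    and "\<mu> \<equiv> mu wmin wmax f \<theta>"
    and "g \<equiv> centred wmin wmax f \<theta>"
    and "E \<equiv> {x \<in> space M. Fin (\<omega> 0 x 0) < wmax}"
  assumes model: "basic_coupling wmin wmax p q f T K Kc"
    and theta: "theta_lower wmin f < ereal \<theta>" "ereal \<theta> < theta_upper wmax f"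
    and prob: "prob_space M"
    and process: "markov_process M config_space T K \<omega>"
    and initial: "distr M config_space (\<omega> 0) = product_mu wmin wmax f \<theta>"
    and coupled_process: "markov_process (restrict_space M E) (config_space \<Otimes>\<^sub>M config_space)
          (ordered_pairs T) Kc (\<lambda>t x. (\<omega> t x, \<omega>p t x))"
    and coupled_initial: "\<And>x. x \<in> E \<Longrightarrow> \<omega>p 0 x = add_particle (\<omega> 0 x) 0"
    and Q_measurable: "\<And>t. 0 \<le> t \<Longrightarrow> Q t \<in> M \<rightarrow>\<^sub>M count_space UNIV"
    and Q_position: "AE x in M. x \<in> E \<longrightarrow> (\<forall>t\<ge>0. \<omega>p t x = add_particle (\<omega> t x) (Q t x))"
  shows "(\<forall>n. \<forall>t\<ge>0.
            integrable M (\<lambda>x. real_of_int (\<omega> t x n)) \<and>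
            integrable M (\<lambda>x. real_of_int (\<omega> 0 x 0)) \<and>
            integrable M (\<lambda>x. real_of_int (\<omega> t x n) * real_of_int (\<omega> 0 x 0)) \<and>
            integrable M (\<lambda>x. indicator {x \<in> E. Q t x = n} x *
                (\<Sum>\<^sub>\<infinity>z\<in>{z \<in> I. \<omega> 0 x 0 < z}. g z * (\<mu> z / \<mu> (\<omega> 0 x 0)))) \<and>
            covariance M (\<lambda>x. real_of_int (\<omega> t x n)) (\<lambda>x. real_of_int (\<omega> 0 x 0)) =
              (\<integral>x. indicator {x \<in> E. Q t x = n} x *
                (\<Sum>\<^sub>\<infinity>z\<in>{z \<in> I. \<omega> 0 x 0 < z}. g z * (\<mu> z / \<mu> (\<omega> 0 x 0))) \<partial>M)) \<and>
         (\<forall>w\<in>I. (\<lambda>z. g z * (\<mu> z / \<mu> w)) summable_on {z \<in> I. w < z} \<and>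
            0 \<le> (\<Sum>\<^sub>\<infinity>z\<in>{z \<in> I. w < z}. g z * (\<mu> z / \<mu> w)))"
proof -
  have Q': "\<And>t. 0 \<le> t \<Longrightarrow> Q t \<in> M \<rightarrow>\<^sub>M count_space UNIV" by (rule Q_measurable)
  interpret second_class_particle wmin wmax p q f T K Kc M \<theta> \<omega> \<omega>p Q E
    by (intro second_class_particle.intro second_class_particle_axioms.intro model prob theta process
        initial coupled_process coupled_initial Q' Q_position) (auto simp: E_def)
  have ratio: "(\<Sum>\<^sub>\<infinity>z\<in>{z \<in> I. w < z}. g z * (\<mu> z / \<mu> w)) = tail_ratio w" for w
    by (simp add: tail_ratio_def I_def g_def \<mu>_def)
  have particle: "{x \<in> E. Q t x = n} = particle_at t n" for t n
    by (simp add: particle_at_def)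
  have summable: "(\<lambda>z. g z * (\<mu> z / \<mu> w)) summable_on {z \<in> I. w < z}" for w
    unfolding I_def g_def \<mu>_def by (rule tail_ratio_summable)
  show ?thesis
    unfolding ratio particle
  proof (intro conjI allI impI ballI)
    fix n and t :: real
    assume t: "0 \<le> t"
    show "integrable M (\<lambda>x. real_of_int (\<omega> t x n))" by (rule integrable_height[OF t])
    show "integrable M (\<lambda>x. real_of_int (\<omega> 0 x 0))" by (rule integrable_height) simp
    show "integrable M (\<lambda>x. real_of_int (\<omega> t x n) * real_of_int (\<omega> 0 x 0))"
      by (rule integrable_height_product[OF t])
    show "integrable M (\<lambda>x. indicator (particle_at t n) x * tail_ratio (\<omega> 0 x 0))"
      by (rule particle_integral_by_levels(1)[OF t])
    show "covariance M (\<lambda>x. real_of_int (\<omega> t x n)) (\<lambda>x. real_of_int (\<omega> 0 x 0)) =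
        (\<integral>x. indicator (particle_at t n) x * tail_ratio (\<omega> 0 x 0) \<partial>M)"
      by (rule covariance_eq_particle_integral[OF t])
  qed (rule summable tail_ratio_nonneg)+
qed

end
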